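(* Let $\mathbf{Z}=(Z_t)_{t\in\mathcal{T}}$ be a standard quadratic harness with respect to its natural past-future filtration, with $\mathbf{Z}\in QH(\eta,\theta;\sigma,\tau;\gamma)$. Fix $r<v$ in $\mathcal{T}$ and real numbers $z_r,z_v$ such that there exists a bridge $\mathbf{X}=(X_t)_{t\in(r,v)}$ of $\mathbf{Z}$ between the points $(r,z_r)$ and $(v,z_v)$. Put $$\Delta=\frac{z_v-z_r}{v-r},\qquad \widetilde\Delta=\frac{v z_r-r z_v}{v-r},$$ $$K(\Delta,\widetilde\Delta)=1+\eta\widetilde\Delta+\theta\Delta+\sigma\widetilde\Delta^2+\tau\Delta^2-(1-\gamma)\Delta\widetilde\Delta,$$ and assume $K(\Delta,\widetilde\Delta)>0$. Then $D:=v(1+r\sigma)+\tau-r\gamma>0$, so that the $f$-transformation $\mathbf{Y}=\mathbf{X}^f$ with $f(x,y)=[x,y]A+\mathbf{m}^T$, $$A=\frac{\sqrt v}{(v-r)M}\begin{bmatrix}1&r\\ 1/v&1\end{bmatrix},\qquad \mathbf{m}^T=-\frac{\sqrt v}{(v-r)M}\left[\frac{z_v}{v},\,z_r\right],\qquad M^2=\frac{K(\Delta,\widetilde\Delta)}{D},$$ i.e. $$Y_t=\frac{\sqrt v}{(v-r)M}\Big(\big(1+\tfrac tv\big)X_{(t+r)/(1+t/v)}-\big(t\tfrac{z_v}{v}+z_r\big)\Big),\qquad t\in(0,\infty),$$ is well defined. Moreover, $\mathbf{Y}\in QH(\widetilde\eta,\widetilde\theta;\widetilde\sigma,\widetilde\tau;\widetilde\gamma)$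 on $(0,\infty)$ (with respect to its natural past-future filtration), where $$\widetilde\eta=\frac{v\eta-\theta-2\tau\Delta+2\sigma v\widetilde\Delta-(1-\gamma)(v\Delta-\widetilde\Delta)}{\sqrt v\,M\,D},\qquad \widetilde\theta=\frac{\sqrt v\,\big(\theta-r\eta+2\tau\Delta-2r\sigma\widetilde\Delta-(1-\gamma)(\widetilde\Delta-r\Delta)\big)}{M\,D},$$ $$\widetilde\sigma=\frac{\sigma v^2+(1-\gamma)v+\tau}{v\,D},\qquad \widetilde\tau=v\,\frac{\sigma r^2+(1-\gamma)r+\tau}{D},\qquad \widetilde\gamma=\frac{v\gamma-r(v\sigma+1)-\tau}{D}.$$
   Context: **Past-future filtration.** For a nonempty open interval $\mathcal{T}\subset(-\infty,\infty)$, a past-future filtration is a family of $\sigma$-fields $(\mathcal{F}_{s,t})_{s<t,\ s,t\in\mathcal{T}}$ with $\mathcal{F}_{r,u}\subset\mathcal{F}_{s,t}$ whenever $r\le s<t\le u$. The natural past-future filtration of a process $(X_t)_{t\in\mathcal{T}}$ is $\mathcal{F}_{s,t}=\sigma(X_r: r\in\mathcal{T},\ r\le s\text{ or }r\ge t)$. **Harness.** An integrable process $(X_t)_{t\in\mathcal{T}}$ such that $X_s,X_t$ are $\mathcal{F}_{s,t}$-measurable is a harness if for all $s<t<u$ in $\mathcal{T}$ $$\mathbb{E}(X_t|\mathcal{F}_{s,u})=\frac{u-t}{u-s}X_s+\frac{t-s}{u-s}X_u .$$ **Standard quadratic harness; notation $QH$.** $\mathbf{X}\in QH(\eta,\theta;\sigma,\tau;\gamma)$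 on $\mathcal{T}\subset(0,\infty)$ means: $\mathbf{X}=(X_t)_{t\in\mathcal{T}}$ is a square-integrable harness, $\mathbb{E}(X_t)=0$, $\mathbb{E}(X_sX_t)=\min\{s,t\}$, and there is a non-random function $F_{t,s,u}$ of $s<t<u$ such that $$\operatorname{Var}(X_t|\mathcal{F}_{s,u})=F_{t,s,u}\Big(1+\eta\tfrac{uX_s-sX_u}{u-s}+\theta\tfrac{X_u-X_s}{u-s}+\sigma\tfrac{(uX_s-sX_u)^2}{(u-s)^2}+\tau\tfrac{(X_u-X_s)^2}{(u-s)^2}-(1-\gamma)\tfrac{(X_u-X_s)(uX_s-sX_u)}{(u-s)^2}\Big).$$ Such an $\mathbf{X}$ is called a standard quadratic harness. Unless specified otherwise the natural past-future filtration is used. **Bridge.** A process $(X_t)_{t\in(r,v)}$ is a bridge between points $(r,z_r)$ and $(v,z_v)$ of a process $(Z_t)_{t\in\mathcal{T}}$ with $(r,v)\subset\mathcal{T}$ if: (1) $\lim_{t\to r^+}X_t=z_r$ and $\lim_{t\to v^-}X_t=z_v$ in probability; (2) for $r<t_1<\dots<t_m<v$ the law of $(X_{t_1},\dots,X_{t_m})$ is absolutely continuous with respect to the law of $(Z_{t_1},\dots,Z_{t_m})$; (3) for $r<s_1<\dots<s_k<t_1<\dots<t_m<u_1<\dots<u_n<v$, writing $Z_{\mathbf t}=(Z_{t_1},\dots,Z_{t_m})$ etc., and any function $g$ with $g(Z_{\mathbf t})$ integrable, if $\mathbb{E}(g(Z_{\mathbf t})|Z_{\mathbf s},Z_{\mathbf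 u})=h(Z_{\mathbf s},Z_{\mathbf u})$ a.s., then $\mathbb{E}(g(X_{\mathbf t})|X_{\mathbf s},X_{\mathbf u})=h(X_{\mathbf s},X_{\mathbf u})$ a.s. (conditional expectation in the extended sense if $g(X_{\mathbf t})$ is not integrable). **$f$-transformation.** For $f(x,y)=[x,y]A+\mathbf{m}^T$ with $A=\begin{bmatrix}a&b\\c&d\end{bmatrix}\in GL_2(\mathbb{R})$, $\mathbf{m}^T=[m_1,m_2]$, let $\varphi(t)=(at+b)/(ct+d)$. For a process $\mathbf{X}$ on an open interval $\mathcal{T}\subset\varphi(\mathbb{R}\setminus\{-d/c\})$, $\mathbf{Y}=\mathbf{X}^f$ is the process on $\varphi^{-1}(\mathcal{T})$ given by $Y_t=(ct+d)X_{\varphi(t)}+m_1t+m_2$. *)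

theory Defs
  imports "HOL-Probability.Probability"
begin

text \<open>A process indexed by \<open>T\<close> is a function \<open>X\<close> whose values \<open>X t\<close> are only
  constrained for \<open>t \<in> T\<close>.\<close>

definition stoch_process :: "'a measure \<Rightarrow> real set \<Rightarrow> (real \<Rightarrow> 'a \<Rightarrow> real) \<Rightarrow> bool" where
  "stoch_process P T X \<longleftrightarrow> prob_space P \<and> (\<forall>t\<in>T. X t \<in> borel_measurable P)"

definition process_sigma :: "'a measure \<Rightarrow> (real \<Rightarrow> 'a \<Rightarrow> real) \<Rightarrow> real set \<Rightarrow> 'a measure" where
  "process_sigma P X I = sigma (space P) {X i -` B \<inter> space P | i B. i \<in> I \<and> B \<in> sets borel}"

definition open_interval :: "real set \<Rightarrow> bool" where
  "open_interval T \<longleftrightarrow> T \<noteq> {} \<and> open T \<and> is_interval T"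

definition past_future_filtration :: "'a measure \<Rightarrow> real set \<Rightarrow> (real \<Rightarrow> real \<Rightarrow> 'a measure) \<Rightarrow> bool" where
  "past_future_filtration P T F \<longleftrightarrow>
     (\<forall>s\<in>T. \<forall>t\<in>T. s < t \<longrightarrow> subalgebra P (F s t)) \<and>
     (\<forall>r\<in>T. \<forall>s\<in>T. \<forall>t\<in>T. \<forall>u\<in>T. r \<le> s \<and> s < t \<and> t \<le> u \<longrightarrow> sets (F r u) \<subseteq> sets (F s t))"

definition natural_filtration ::
  "'a measure \<Rightarrow> real set \<Rightarrow> (real \<Rightarrow> 'a \<Rightarrow> real) \<Rightarrow> real \<Rightarrow> real \<Rightarrow> 'a measure" where
  "natural_filtration P T X s t = process_sigma P X {r \<in> T. r \<le> s \<or> t \<le> r}"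

definition harness ::
  "'a measure \<Rightarrow> real set \<Rightarrow> (real \<Rightarrow> real \<Rightarrow> 'a measure) \<Rightarrow> (real \<Rightarrow> 'a \<Rightarrow> real) \<Rightarrow> bool" where
  "harness P T F X \<longleftrightarrow>
     open_interval T \<and> stoch_process P T X \<and> past_future_filtration P T F \<and>
     (\<forall>t\<in>T. integrable P (X t)) \<and>
     (\<forall>s\<in>T. \<forall>t\<in>T. s < t \<longrightarrow>
        X s \<in> borel_measurable (F s t) \<and> X t \<in> borel_measurable (F s t)) \<and>
     (\<forall>s\<in>T. \<forall>t\<in>T. \<forall>u\<in>T. s < t \<and> t < u \<longrightarrow>
        (AE \<omega> in P. real_cond_exp P (F s u) (X t) \<omega> =
           (u - t) / (u - s) * X s \<omega> + (t - s) / (u - s) * X u \<omega>))"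

definition cond_var :: "'a measure \<Rightarrow> 'a measure \<Rightarrow> ('a \<Rightarrow> real) \<Rightarrow> 'a \<Rightarrow> real" where
  "cond_var P G Y = real_cond_exp P G (\<lambda>\<omega>. (Y \<omega> - real_cond_exp P G Y \<omega>)\<^sup>2)"

definition qh_K :: "real \<Rightarrow> real \<Rightarrow> real \<Rightarrow> real \<Rightarrow> real \<Rightarrow> real \<Rightarrow> real \<Rightarrow> real" where
  "qh_K \<eta> \<theta> \<sigma> \<tau> \<gamma> \<Delta> \<Delta>' =
     1 + \<eta> * \<Delta>' + \<theta> * \<Delta> + \<sigma> * \<Delta>'\<^sup>2 + \<tau> * \<Delta>\<^sup>2 - (1 - \<gamma>) * \<Delta> * \<Delta>'"

definition QH ::
  "'a measure \<Rightarrow> real set \<Rightarrow> (real \<Rightarrow> real \<Rightarrow> 'a measure) \<Rightarrow>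
   real \<Rightarrow> real \<Rightarrow> real \<Rightarrow> real \<Rightarrow> real \<Rightarrow> (real \<Rightarrow> 'a \<Rightarrow> real) \<Rightarrow> bool" where
  "QH P T F \<eta> \<theta> \<sigma> \<tau> \<gamma> X \<longleftrightarrow>
     T \<subseteq> {0<..} \<and> harness P T F X \<and>
     (\<forall>t\<in>T. integrable P (\<lambda>\<omega>. (X t \<omega>)\<^sup>2)) \<and>
     (\<forall>t\<in>T. (\<integral>\<omega>. X t \<omega> \<partial>P) = 0) \<and>
     (\<forall>s\<in>T. \<forall>t\<in>T. (\<integral>\<omega>. X s \<omega> * X t \<omega> \<partial>P) = min s t) \<and>
     (\<exists>C :: real \<Rightarrow> real \<Rightarrow> real \<Rightarrow> real. \<forall>s\<in>T. \<forall>t\<in>T. \<forall>u\<in>T. s < t \<and> t < u \<longrightarrow>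
        (AE \<omega> in P. cond_var P (F s u) (X t) \<omega> =
           C t s u * qh_K \<eta> \<theta> \<sigma> \<tau> \<gamma>
             ((X u \<omega> - X s \<omega>) / (u - s)) ((u * X s \<omega> - s * X u \<omega>) / (u - s))))"

definition tendsto_in_prob ::
  "'a measure \<Rightarrow> ('b \<Rightarrow> 'a \<Rightarrow> real) \<Rightarrow> real \<Rightarrow> 'b filter \<Rightarrow> bool" where
  "tendsto_in_prob P X z F \<longleftrightarrow>
     (\<forall>\<epsilon>>0. ((\<lambda>t. measure P {\<omega> \<in> space P. \<bar>X t \<omega> - z\<bar> > \<epsilon>}) \<longlongrightarrow> 0) F)"

text \<open>\<open>E(Y | G) = h\<close> in the extended sense, for a finite \<open>h\<close> and a possibly non-integrable \<open>Y\<close>: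
  the \<open>[0,\<infinity>]\<close>-valued conditional expectations of the positive and negative parts of \<open>Y\<close> are
  a.s. finite and their difference, which is \<^const>\<open>real_cond_exp\<close> by definition, is \<open>h\<close>.
  The coercion \<^const>\<open>ennreal\<close> truncates at 0, so it produces the positive part. Finiteness has
  to be stated because \<^const>\<open>real_cond_exp\<close> replaces infinite values by 0; it is automatic for
  integrable \<open>Y\<close>.\<close>

definition ext_cond_exp_is :: "'a measure \<Rightarrow> 'a measure \<Rightarrow> ('a \<Rightarrow> real) \<Rightarrow> ('a \<Rightarrow> real) \<Rightarrow> bool" where
  "ext_cond_exp_is P G Y h \<longleftrightarrow>
     (AE \<omega> in P. nn_cond_exp P G (\<lambda>\<omega>. ennreal (Y \<omega>)) \<omega> < \<infinity> \<and>
                nn_cond_exp P G (\<lambda>\<omega>. ennreal (- Y \<omega>)) \<omega> < \<infinity> \<and>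
                real_cond_exp P G Y \<omega> = h \<omega>)"

text \<open>The vector of the \<open>X t\<close>, \<open>t \<in> J\<close>, as an element of the product space indexed by \<open>J\<close>. An
  increasing tuple \<open>t\<^sub>1 < \<dots> < t\<^sub>m\<close> is represented by the finite nonempty set of its entries.\<close>

definition proc_vec :: "(real \<Rightarrow> 'a \<Rightarrow> real) \<Rightarrow> real set \<Rightarrow> 'a \<Rightarrow> (real \<Rightarrow> real)" where
  "proc_vec X J \<omega> = (\<lambda>t\<in>J. X t \<omega>)"

definition bridge ::
  "'a measure \<Rightarrow> real set \<Rightarrow> (real \<Rightarrow> 'a \<Rightarrow> real) \<Rightarrow> real \<Rightarrow> real \<Rightarrow> real \<Rightarrow> real \<Rightarrow>
   'b measure \<Rightarrow> (real \<Rightarrow> 'b \<Rightarrow> real) \<Rightarrow> bool" where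
  "bridge P T Z r z\<^sub>r v z\<^sub>v Q X \<longleftrightarrow>
     r < v \<and> {r<..<v} \<subseteq> T \<and> stoch_process P T Z \<and> stoch_process Q {r<..<v} X \<and>
     tendsto_in_prob Q X z\<^sub>r (at_right r) \<and> tendsto_in_prob Q X z\<^sub>v (at_left v) \<and>
     (\<forall>J. finite J \<and> J \<noteq> {} \<and> J \<subseteq> {r<..<v} \<longrightarrow>
        absolutely_continuous
          (distr P (Pi\<^sub>M J (\<lambda>_. borel)) (proc_vec Z J))
          (distr Q (Pi\<^sub>M J (\<lambda>_. borel)) (proc_vec X J))) \<and>
     (\<forall>S J U. finite S \<and> finite J \<and> finite U \<and> S \<noteq> {} \<and> J \<noteq> {} \<and> U \<noteq> {} \<and>
        S \<subseteq> {r<..<v} \<and> J \<subseteq> {r<..<v} \<and> U \<subseteq> {r<..<v} \<and>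
        (\<forall>s\<in>S. \<forall>t\<in>J. s < t) \<and> (\<forall>t\<in>J. \<forall>u\<in>U. t < u) \<longrightarrow>
        (\<forall>g \<in> borel_measurable (Pi\<^sub>M J (\<lambda>_. borel)).
         \<forall>h \<in> borel_measurable (Pi\<^sub>M (S \<union> U) (\<lambda>_. borel)).
           integrable P (\<lambda>\<omega>. g (proc_vec Z J \<omega>)) \<and>
           (AE \<omega> in P. real_cond_exp P (process_sigma P Z (S \<union> U)) (\<lambda>\<omega>. g (proc_vec Z J \<omega>)) \<omega>
                        = h (proc_vec Z (S \<union> U) \<omega>)) \<longrightarrow>
           ext_cond_exp_is Q (process_sigma Q X (S \<union> U))
             (\<lambda>\<omega>. g (proc_vec X J \<omega>)) (\<lambda>\<omega>. h (proc_vec X (S \<union> U) \<omega>))))"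

definition moebius :: "real^2^2 \<Rightarrow> real \<Rightarrow> real" where
  "moebius A t = (A$1$1 * t + A$1$2) / (A$2$1 * t + A$2$2)"

text \<open>The set of all \<open>t\<close> at which the Moebius map is defined. For \<open>A$2$1 = 0\<close> it is the whole
  line if \<open>A\<close> is invertible.\<close>

definition moebius_dom :: "real^2^2 \<Rightarrow> real set" where
  "moebius_dom A = {t. A$2$1 * t + A$2$2 \<noteq> 0}"

text \<open>The time set of the transform of a process on \<open>T\<close>, i.e. the preimage of \<open>T\<close>.\<close>

definition f_transform_times :: "real^2^2 \<Rightarrow> real set \<Rightarrow> real set" where
  "f_transform_times A T = {t \<in> moebius_dom A. moebius A t \<in> T}"

definition f_transform_defined :: "real^2^2 \<Rightarrow> real set \<Rightarrow> bool" where
  "f_transform_defined A T \<longleftrightarrow> invertible A \<and> open_interval T \<and> T \<subseteq> moebius A ` moebius_dom A"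

definition f_transform ::
  "real^2^2 \<Rightarrow> real^2 \<Rightarrow> (real \<Rightarrow> 'a \<Rightarrow> real) \<Rightarrow> real \<Rightarrow> 'a \<Rightarrow> real" where
  "f_transform A m X t \<omega> =
     (A$2$1 * t + A$2$2) * X (moebius A t) \<omega> + m$1 * t + m$2"

end

theory Submission
  imports Defs
begin

text \<open>Taking expectations in the formula for the conditional variance of \<open>Z\<close> gives
  \<open>F\<^sub>t\<^sub>s\<^sub>u (u (1 + s \<sigma>) + \<tau> - s \<gamma>) = (t - s) (u - t)\<close>. The formulas for
  \<open>E(X\<^sub>t | X\<^sub>s, X\<^sub>u)\<close> and \<open>E((X\<^sub>t - a)\<^sup>2 | X\<^sub>s, X\<^sub>u)\<close> are inherited from \<open>Z\<close>. Along
  sequences \<open>s \<rightarrow> r\<close>, \<open>u \<rightarrow> v\<close> on which \<open>X\<close> converges almost surely to the end points, their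
  right-hand sides converge to constants. Nonnegativity of the conditional variance then forces
  \<open>D > 0\<close>, and Fatou's lemma with \<open>a\<close> the value at \<open>t\<close> of the chord between the end points
  gives \<open>E (X\<^sub>t - a)\<^sup>2 \<le> (t - r) (v - t) K / D\<close>. So the deviation \<open>W\<close> of \<open>X\<close> from the chord
  tends to 0 in \<open>L\<^sup>2\<close> at both ends, and passing to the limit in the harness identities yields
  the mean and covariance of \<open>W\<close>. A Dynkin argument passes from finitely many conditioning times
  to the natural filtration. The process \<open>Y\<close> is \<open>W\<close> after a scaling and a time change that
  preserve the past-future filtration, and its parameters are read off by expanding \<open>K\<close>
  around the end points.\<close>

section \<open>Processes and conditional expectations\<close>

text \<open>The end points are not times of the bridge and no moments of \<open>X\<close> are given,
  so nothing can be conditioned on them directly. Hence two passes over the same limit: Fatou yields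
  only an upper bound for the second moment and, with it, integrability. Only then can expectations
  be taken in the harness formulas. By Cauchy-Schwarz, covariances with a factor near an end point
  vanish, and the bound becomes an equality.

  The form of \<open>Y\<close> comes from the resulting covariance
  \<open>(s - r) * (v - t) * K / D\<close> of \<open>W s\<close> and \<open>W t\<close>,
  \<open>s < t\<close>. After division of each \<open>W t\<close> by \<open>v - t\<close> it depends
  on the earlier time only, through \<open>(s - r) / (v - s)\<close>. With
  \<open>v * (s - r) / (v - s)\<close> as the new time it is a multiple of the minimum. The inverse
  of this time map is the Moebius map of \<open>A\<close>, and \<open>M\<close> fixes the multiple.
  Such a rescaling combined with a Moebius time change sends affine functions of time to affine
  functions, so linear interpolation survives and \<open>K\<close> only undergoes an affine
  substitution of its arguments.\<close>

lemma sets_process_sigma: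
  "sets (process_sigma P X I) =
     sigma_sets (space P) {X i -` B \<inter> space P | i B. i \<in> I \<and> B \<in> sets borel}"
  unfolding process_sigma_def by (rule sets_measure_of) auto

lemma space_process_sigma [simp]: "space (process_sigma P X I) = space P"
  unfolding process_sigma_def by (rule space_measure_of) auto

lemma process_sigma_mono:
  "I \<subseteq> J \<Longrightarrow> sets (process_sigma P X I) \<subseteq> sets (process_sigma P X J)"
  unfolding sets_process_sigma by (rule sigma_sets_mono') blast

lemma process_sigma_subalgebra_mono:
  "I \<subseteq> J \<Longrightarrow> subalgebra (process_sigma P X J) (process_sigma P X I)"
  by (simp add: subalgebra_def process_sigma_mono)

lemma subalgebra_process_sigma:
  assumes "\<And>i. i \<in> I \<Longrightarrow> X i \<in> borel_measurable P"
  shows "subalgebra P (process_sigma P X I)"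
  unfolding subalgebra_def sets_process_sigma
  using assms by (auto intro!: sets.sigma_sets_subset simp: measurable_sets)

lemma measurable_process_sigma:
  assumes "i \<in> I"
  shows "X i \<in> borel_measurable (process_sigma P X I)"
proof (rule measurableI)
  fix B :: "real set" assume "B \<in> sets borel"
  then show "X i -` B \<inter> space (process_sigma P X I) \<in> sets (process_sigma P X I)"
    unfolding sets_process_sigma using assms by (auto intro!: sigma_sets.Basic)
qed simp

lemma measurable_proc_vec:
  assumes "\<And>i. i \<in> I \<Longrightarrow> X i \<in> borel_measurable M"
  shows "proc_vec X I \<in> measurable M (Pi\<^sub>M I (\<lambda>_. borel))"
proof -
  have "(\<lambda>\<omega>. \<lambda>i\<in>I. X i \<omega>) \<in> measurable M (Pi\<^sub>M I (\<lambda>_. borel))"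
    by (rule measurable_restrict) (use assms in auto)
  then show ?thesis unfolding proc_vec_def[abs_def] .
qed

lemma sigma_finite_process_sigma:
  assumes "prob_space P" "\<And>i. i \<in> I \<Longrightarrow> X i \<in> borel_measurable P"
  shows "sigma_finite_subalgebra P (process_sigma P X I)"
proof -
  interpret prob_space P by fact
  interpret finite_measure_subalgebra P "process_sigma P X I"
    by unfold_locales (rule subalgebra_process_sigma[OF assms(2)])
  show ?thesis by unfold_locales
qed

text \<open>Invertible affine maps of the line are Borel in both directions, so even the generating
  families of preimages coincide. This identifies conditioning on \<open>Y\<close> with conditioning
  on \<open>X\<close>.\<close>

lemma process_sigma_time_change:
  assumes "bij_betw \<phi> I J"
    and "\<And>i. i \<in> I \<Longrightarrow> a i \<noteq> 0"
    and "\<And>i \<omega>. i \<in> I \<Longrightarrow> Y i \<omega> = a i * X (\<phi> i) \<omega> + b i"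
  shows "process_sigma P Y I = process_sigma P X J"
proof -
  have J: "J = \<phi> ` I" using assms(1) by (simp add: bij_betw_def)
  have "{Y i -` B \<inter> space P | i B. i \<in> I \<and> B \<in> sets borel} =
        {X j -` B \<inter> space P | j B. j \<in> J \<and> B \<in> sets borel}" (is "?L = ?R")
  proof (intro set_eqI iffI)
    fix A assume "A \<in> ?L"
    then obtain i B where i: "A = Y i -` B \<inter> space P" "i \<in> I" "B \<in> sets borel" by auto
    have "(\<lambda>x. a i * x + b i) -` B \<in> sets borel"
      using i(3) by (auto intro!: measurable_sets_borel)
    moreover have "A = X (\<phi> i) -` ((\<lambda>x. a i * x + b i) -` B) \<inter> space P"
      using i assms(3) by auto
    ultimately show "A \<in> ?R" using i(2) J by blast
  next
    fix A assume "A \<in> ?R"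
    then obtain i B where i: "A = X (\<phi> i) -` B \<inter> space P" "i \<in> I" "B \<in> sets borel"
      using J by auto
    have "(\<lambda>y. (y - b i) / a i) -` B \<in> sets borel"
      using i(3) by (auto intro!: measurable_sets_borel)
    moreover have "A = Y i -` ((\<lambda>y. (y - b i) / a i) -` B) \<inter> space P"
      using i assms by auto
    ultimately show "A \<in> ?L" using i(2) by blast
  qed
  then show ?thesis unfolding process_sigma_def by simp
qed

section \<open>From finitely many conditioning times to the natural filtration\<close>

text \<open>Events that depend on finitely many indices form an intersection-stable generator, and
  the sets on which the two integrals agree form a Dynkin system. The base set \<open>I0\<close> is
  there because agreement is known only for index sets that contain the two neighbouring
  times.\<close>

lemma set_integral_eq_process_sigma:
  fixes f g :: "'a \<Rightarrow> real"
  assumes X: "\<And>i. i \<in> I \<Longrightarrow> X i \<in> borel_measurable P"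
    and f: "integrable P f" and g: "integrable P g"
    and I0: "finite I0" "I0 \<subseteq> I"
    and fin: "\<And>I' A. finite I' \<Longrightarrow> I0 \<subseteq> I' \<Longrightarrow> I' \<subseteq> I \<Longrightarrow> A \<in> sets (process_sigma P X I') \<Longrightarrow>
       (\<integral>x\<in>A. f x \<partial>P) = (\<integral>x\<in>A. g x \<partial>P)"
    and A: "A \<in> sets (process_sigma P X I)"
  shows "(\<integral>x\<in>A. f x \<partial>P) = (\<integral>x\<in>A. g x \<partial>P)"
proof -
  define G where "G = (\<Union>I'\<in>{I'. finite I' \<and> I0 \<subseteq> I' \<and> I' \<subseteq> I}. sets (process_sigma P X I'))"
  have GI: "B \<in> G" if "finite I'" "I0 \<subseteq> I'" "I' \<subseteq> I" "B \<in> sets (process_sigma P X I')" for B I'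
    using that unfolding G_def by blast
  have G_sub: "G \<subseteq> sets (process_sigma P X I)"
    unfolding G_def using process_sigma_mono by blast
  have sub: "subalgebra P (process_sigma P X I)"
    by (rule subalgebra_process_sigma[OF X])
  have G_space: "G \<subseteq> Pow (space P)"
    using G_sub sets.sets_into_space[of _ "process_sigma P X I"] by auto
  have top: "space P \<in> G"
    using GI[OF I0(1) order_refl I0(2), of "space P"]
      sets.top[of "process_sigma P X I0"] by simp
  have stable: "Int_stable G"
  proof (rule Int_stableI)
    fix B C assume "B \<in> G" "C \<in> G"
    then obtain J K where J: "finite J" "I0 \<subseteq> J" "J \<subseteq> I" "B \<in> sets (process_sigma P X J)"
      and K: "finite K" "I0 \<subseteq> K" "K \<subseteq> I" "C \<in> sets (process_sigma P X K)"
      unfolding G_def by auto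
    have "B \<in> sets (process_sigma P X (J \<union> K))" "C \<in> sets (process_sigma P X (J \<union> K))"
      using J K process_sigma_mono[of J "J \<union> K"] process_sigma_mono[of K "J \<union> K"] by blast+
    then show "B \<inter> C \<in> G"
      using J K by (intro GI[of "J \<union> K"]) auto
  qed
  \<comment> \<open>An event of a single index \<open>i\<close> lies in \<open>G\<close> once
    \<open>I0\<close> is adjoined to \<open>{i}\<close>.\<close>
  have "A \<in> sigma_sets (space P) G"
  proof -
    have "{X i -` B \<inter> space P | i B. i \<in> I \<and> B \<in> sets borel} \<subseteq> G"
    proof safe
      fix i and B :: "real set" assume i: "i \<in> I" "B \<in> sets borel"
      then have "X i -` B \<inter> space P \<in> sets (process_sigma P X (insert i I0))"
        using measurable_sets[OF measurable_process_sigma[of i "insert i I0" X P] i(2)] by simp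
      then show "X i -` B \<inter> space P \<in> G" using i I0 by (intro GI[of "insert i I0"]) auto
    qed
    then show ?thesis using A sigma_sets_mono' unfolding sets_process_sigma by blast
  qed
  have si: "set_integrable P B h" if "B \<in> sets P" "integrable P h" for B and h :: "'a \<Rightarrow> real"
    unfolding set_integrable_def using that by (rule integrable_mult_indicator)
  from stable G_space \<open>A \<in> sigma_sets (space P) G\<close> show ?thesis
  proof (induction rule: sigma_sets_induct_disjoint)
    case (basic A)
    then show ?case using fin unfolding G_def by auto
  next
    case empty
    then show ?case by (simp add: set_lebesgue_integral_def)
  next
    case (compl A)
    have A: "A \<in> sets P"
      using compl(1) G_sub sets.sigma_sets_subset[of G "process_sigma P X I"] sub
      unfolding subalgebra_def by auto
    have eq: "(\<integral>x\<in>space P. h x \<partial>P) = (\<integral>x\<in>A. h x \<partial>P) + (\<integral>x\<in>space P - A. h x \<partial>P)"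
      if "integrable P h" for h :: "'a \<Rightarrow> real"
      using set_integral_Un[of A "space P - A" P h] si[OF A that] si[OF _ that, of "space P - A"]
        sets.sets_into_space[OF A] A
      by (auto simp: Un_absorb1)
    \<comment> \<open>The total integrals agree since the whole space is in \<open>G\<close>;
      complements then follow by subtraction.\<close>
    have "(\<integral>x\<in>space P. f x \<partial>P) = (\<integral>x\<in>space P. g x \<partial>P)"
      using top fin unfolding G_def by auto
    then show ?case using eq[OF f] eq[OF g] compl(2) by simp
  next
    case (union B)
    have B: "B i \<in> sets P" for i
      using union(2) G_sub sets.sigma_sets_subset[of G "process_sigma P X I"] sub
      unfolding subalgebra_def by auto
    have disj: "\<And>i j. i \<noteq> j \<Longrightarrow> B i \<inter> B j = {}"
      using union(1) by (auto simp: disjoint_family_on_def)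
    have eq: "(\<integral>x\<in>(\<Union>i. B i). h x \<partial>P) = (\<Sum>i. (\<integral>x\<in>B i. h x \<partial>P))"
      if "integrable P h" for h :: "'a \<Rightarrow> real"
      using B disj si[OF _ that, of "\<Union>i. B i"] by (intro lebesgue_integral_countable_add) auto
    show ?case using eq[OF f] eq[OF g] union(3) by simp
  qed
qed

text \<open>The point is that one and the same \<open>h\<close> works for every finite index set
  above \<open>I0\<close>: then its defining integral identities hold on a generator and extend by
  the preceding Dynkin argument.\<close>

lemma real_cond_exp_process_sigmaI:
  assumes P: "prob_space P"
    and X: "\<And>i. i \<in> I \<Longrightarrow> X i \<in> borel_measurable P"
    and f: "integrable P f" and h: "integrable P h"
    and hm: "h \<in> borel_measurable (process_sigma P X I)"
    and I0: "finite I0" "I0 \<subseteq> I"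
    and fin: "\<And>I'. finite I' \<Longrightarrow> I0 \<subseteq> I' \<Longrightarrow> I' \<subseteq> I \<Longrightarrow>
       AE \<omega> in P. real_cond_exp P (process_sigma P X I') f \<omega> = h \<omega>"
  shows "AE \<omega> in P. real_cond_exp P (process_sigma P X I) f \<omega> = h \<omega>"
proof -
  interpret sigma_finite_subalgebra P "process_sigma P X I"
    by (rule sigma_finite_process_sigma[OF P X])
  show ?thesis
  proof (rule real_cond_exp_charact[OF _ f h hm])
    fix A assume "A \<in> sets (process_sigma P X I)"
    from X f h I0 _ this show "(\<integral>x\<in>A. f x \<partial>P) = (\<integral>x\<in>A. h x \<partial>P)"
    proof (rule set_integral_eq_process_sigma)
      fix I' A assume I': "finite I'" "I0 \<subseteq> I'" "I' \<subseteq> I" and A: "A \<in> sets (process_sigma P X I')"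
      interpret I': sigma_finite_subalgebra P "process_sigma P X I'"
        by (rule sigma_finite_process_sigma[OF P]) (use X I' in auto)
      have AP: "A \<in> sets P" using A I'.subalg by (auto simp: subalgebra_def)
      have "(\<integral>x\<in>A. f x \<partial>P) = (\<integral>x\<in>A. real_cond_exp P (process_sigma P X I') f x \<partial>P)"
        by (rule I'.real_cond_exp_intA[OF f A])
      also have "\<dots> = (\<integral>x\<in>A. h x \<partial>P)"
        using fin[OF I'] AP h by (intro set_lebesgue_integral_cong_AE) auto
      finally show "(\<integral>x\<in>A. f x \<partial>P) = (\<integral>x\<in>A. h x \<partial>P)" .
    qed
  qed
qed

section \<open>Limits in probability and in conditional expectations\<close>

text \<open>Choosing \<open>s n\<close> with probability below \<open>2^-n\<close> of a deviation
  above \<open>2^-n\<close> makes Borel-Cantelli applicable. The predicates \<open>R n\<close> let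
  the caller impose further properties on the times, such as a rate of approach to the end
  point.\<close>

lemma tendsto_in_prob_imp_AE_seq:
  fixes X :: "'i \<Rightarrow> 'a \<Rightarrow> real"
  assumes P: "prob_space P" and X: "tendsto_in_prob P X z F" and F: "F \<noteq> bot"
    and meas: "eventually (\<lambda>t. X t \<in> borel_measurable P) F"
    and R: "\<And>n. eventually (R n) F"
  obtains s :: "nat \<Rightarrow> 'i" where "\<And>n. R n (s n)" "AE \<omega> in P. (\<lambda>n. X (s n) \<omega>) \<longlonglongrightarrow> z"
proof -
  interpret prob_space P by fact
  define e where "e n = (1/2::real) ^ n" for n
  have e: "e n > 0" for n by (simp add: e_def)
  have "\<exists>t. R n t \<and> X t \<in> borel_measurable P \<and>
      measure P {\<omega> \<in> space P. \<bar>X t \<omega> - z\<bar> > e n} < e n" for n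
  proof -
    have "eventually (\<lambda>t. measure P {\<omega> \<in> space P. \<bar>X t \<omega> - z\<bar> > e n} < e n) F"
      using X e[of n] unfolding tendsto_in_prob_def by (intro order_tendstoD(2)) auto
    from eventually_conj[OF R[of n] eventually_conj[OF meas this]] show ?thesis
      using eventually_happens'[OF F] by blast
  qed
  then obtain s where s: "\<And>n. R n (s n)" "\<And>n. X (s n) \<in> borel_measurable P"
    "\<And>n. measure P {\<omega> \<in> space P. \<bar>X (s n) \<omega> - z\<bar> > e n} < e n" by metis
  note s(2)[measurable]
  have "AE \<omega> in P. eventually (\<lambda>n. \<omega> \<in> space P - {\<omega> \<in> space P. \<bar>X (s n) \<omega> - z\<bar> > e n}) sequentially"
  proof (rule borel_cantelli_AE1)
    show "summable (\<lambda>n. measure P {\<omega> \<in> space P. \<bar>X (s n) \<omega> - z\<bar> > e n})"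
    proof (rule summable_comparison_test'[where N = 0])
      show "summable e" unfolding e_def by (rule summable_geometric) simp
      show "norm (measure P {\<omega> \<in> space P. \<bar>X (s n) \<omega> - z\<bar> > e n}) \<le> e n" for n
        using less_imp_le[OF s(3)[of n]] by simp
    qed
  qed (auto simp: emeasure_eq_measure)
  then have "AE \<omega> in P. (\<lambda>n. X (s n) \<omega>) \<longlonglongrightarrow> z"
  proof eventually_elim
    case (elim \<omega>)
    have "e \<longlonglongrightarrow> 0" unfolding e_def by (rule LIMSEQ_power_zero) simp
    moreover have "eventually (\<lambda>n. norm (X (s n) \<omega> - z) \<le> e n) sequentially"
      using elim by eventually_elim auto
    ultimately have "(\<lambda>n. X (s n) \<omega> - z) \<longlonglongrightarrow> 0" by (rule Lim_null_comparison[rotated])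
    then show ?case by (simp add: LIM_zero_iff)
  qed
  with s(1) show ?thesis by (rule that)
qed

text \<open>The negative part vanishes, so the real conditional expectation is the truncation of the
  one in \<open>[0, \<infinity>]\<close>. The finiteness recorded in \<open>ext_cond_exp_is\<close>
  ensures that the truncation loses nothing.\<close>

lemma ext_cond_exp_is_nn_cond_exp:
  assumes G: "sigma_finite_subalgebra P G" and f: "f \<in> borel_measurable P" "\<And>\<omega>. 0 \<le> f \<omega>"
    and ext: "ext_cond_exp_is P G f h"
  shows "AE \<omega> in P. nn_cond_exp P G (\<lambda>\<omega>. ennreal (f \<omega>)) \<omega> = ennreal (h \<omega>)"
proof -
  interpret sigma_finite_subalgebra P G by fact
  have "(\<lambda>\<omega>. ennreal (- f \<omega>)) = (\<lambda>\<omega>. 0)"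
    by (simp add: f(2) ennreal_neg)
  then have "AE \<omega> in P. nn_cond_exp P G (\<lambda>\<omega>. ennreal (- f \<omega>)) \<omega> = 0"
    using nn_cond_exp_F_meas[of "\<lambda>_. 0"] by auto
  with ext[unfolded ext_cond_exp_is_def] show ?thesis
    by eventually_elim (auto simp: real_cond_exp_def dest!: ennreal_enn2real)
qed

text \<open>Fatou on the events \<open>{h n \<le> c + e}\<close>, which exhaust the space.\<close>

lemma nn_integral_le_of_cond_exp_limit:
  assumes P: "prob_space P" and f: "f \<in> borel_measurable P" "\<And>\<omega>. 0 \<le> f \<omega>"
    and G: "\<And>n. subalgebra P (G n)" and h: "\<And>n. h n \<in> borel_measurable (G n)"
    and ext: "\<And>n. ext_cond_exp_is P (G n) f (h n)"
    and lim: "AE \<omega> in P. (\<lambda>n. h n \<omega>) \<longlonglongrightarrow> c" and c: "0 \<le> c"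
  shows "(\<integral>\<^sup>+\<omega>. ennreal (f \<omega>) \<partial>P) \<le> ennreal c"
proof (rule ennreal_le_epsilon)
  fix e :: real assume e: "0 < e"
  interpret prob_space P by fact
  define A where "A n = {\<omega> \<in> space (G n). h n \<omega> \<le> c + e}" for n
  have AG: "A n \<in> sets (G n)" for n
    unfolding A_def using h[of n] by measurable
  have AP[measurable]: "A n \<in> sets P" for n using AG G[of n] by (auto simp: subalgebra_def)
  note f(1)[measurable]
  \<comment> \<open>\<open>A n\<close> belongs to \<open>G n\<close>, so on it \<open>f\<close> may
    be replaced by its conditional expectation \<open>h n\<close>, which is at most
    \<open>c + e\<close> there.\<close>
  have bound: "(\<integral>\<^sup>+\<omega>. indicator (A n) \<omega> * ennreal (f \<omega>) \<partial>P) \<le> ennreal (c + e)" for n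
  proof -
    interpret Gn: finite_measure_subalgebra P "G n" by unfold_locales (rule G)
    have "(\<integral>\<^sup>+\<omega>. indicator (A n) \<omega> * ennreal (f \<omega>) \<partial>P) =
      (\<integral>\<^sup>+\<omega>. indicator (A n) \<omega> * nn_cond_exp P (G n) (\<lambda>\<omega>. ennreal (f \<omega>)) \<omega> \<partial>P)"
      using AG by (intro Gn.nn_cond_exp_intg[symmetric]) auto
    also have "\<dots> = (\<integral>\<^sup>+\<omega>. indicator (A n) \<omega> * ennreal (h n \<omega>) \<partial>P)"
      using ext_cond_exp_is_nn_cond_exp[OF Gn.sigma_finite_subalgebra_axioms f ext[of n]]
      by (intro nn_integral_cong_AE) auto
    also have "\<dots> \<le> (\<integral>\<^sup>+\<omega>. ennreal (c + e) \<partial>P)"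
      by (intro nn_integral_mono) (auto simp: A_def indicator_def intro: ennreal_leI)
    also have "\<dots> = ennreal (c + e)" by (simp add: emeasure_space_1)
    finally show ?thesis .
  qed
  have "AE \<omega> in P. ennreal (f \<omega>) = liminf (\<lambda>n. indicator (A n) \<omega> * ennreal (f \<omega>))"
    using lim AE_space
  proof eventually_elim
    case (elim \<omega>)
    have "eventually (\<lambda>n. h n \<omega> < c + e) sequentially"
      using elim e by (intro order_tendstoD(2)) auto
    then have "eventually (\<lambda>n. ennreal (f \<omega>) = indicator (A n) \<omega> * ennreal (f \<omega>)) sequentially"
    proof eventually_elim
      case (elim n)
      then show ?case using \<open>\<omega> \<in> space P\<close> G[of n] by (auto simp: A_def subalgebra_def)
    qed
    then have "(\<lambda>n. indicator (A n) \<omega> * ennreal (f \<omega>)) \<longlonglongrightarrow> ennreal (f \<omega>)"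
      by (rule Lim_transform_eventually[OF tendsto_const])
    then show ?case by (simp add: lim_imp_Liminf)
  qed
  then have "(\<integral>\<^sup>+\<omega>. ennreal (f \<omega>) \<partial>P) =
      (\<integral>\<^sup>+\<omega>. liminf (\<lambda>n. indicator (A n) \<omega> * ennreal (f \<omega>)) \<partial>P)"
    by (rule nn_integral_cong_AE)
  also have "\<dots> \<le> liminf (\<lambda>n. \<integral>\<^sup>+\<omega>. indicator (A n) \<omega> * ennreal (f \<omega>) \<partial>P)"
    by (intro nn_integral_liminf) simp
  also have "\<dots> \<le> ennreal (c + e)"
    by (intro Liminf_le always_eventually allI bound) simp
  finally show "(\<integral>\<^sup>+\<omega>. ennreal (f \<omega>) \<partial>P) \<le> ennreal c + ennreal e"
    using c e by (simp add: ennreal_plus)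
qed

section \<open>Second moments\<close>

lemma integrable_mult_of_squares:
  fixes f g :: "'a \<Rightarrow> real"
  assumes [measurable]: "f \<in> borel_measurable M" "g \<in> borel_measurable M"
    and "integrable M (\<lambda>\<omega>. (f \<omega>)\<^sup>2)" "integrable M (\<lambda>\<omega>. (g \<omega>)\<^sup>2)"
  shows "integrable M (\<lambda>\<omega>. f \<omega> * g \<omega>)"
proof (rule Bochner_Integration.integrable_bound)
  show "integrable M (\<lambda>\<omega>. (f \<omega>)\<^sup>2 + (g \<omega>)\<^sup>2)" using assms by simp
  have "\<bar>x * y\<bar> \<le> x\<^sup>2 + y\<^sup>2" for x y :: real
  proof -
    have "2 * \<bar>x * y\<bar> \<le> x\<^sup>2 + y\<^sup>2"
      using sum_squares_bound[of "\<bar>x\<bar>" "\<bar>y\<bar>"] by (simp add: abs_mult)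
    then show ?thesis using abs_ge_zero[of "x * y"] by linarith
  qed
  then show "AE \<omega> in M. norm (f \<omega> * g \<omega>) \<le> norm ((f \<omega>)\<^sup>2 + (g \<omega>)\<^sup>2)" by simp
qed simp

text \<open>Cauchy-Schwarz, from nonnegativity of the quadratic form that sends
  \<open>(x, y)\<close> to the integral of \<open>(x * f + y * g)\<^sup>2\<close>.\<close>

lemma integral_mult_power2_le:
  fixes f g :: "'a \<Rightarrow> real"
  assumes m: "f \<in> borel_measurable M" "g \<in> borel_measurable M"
    and i: "integrable M (\<lambda>\<omega>. (f \<omega>)\<^sup>2)" "integrable M (\<lambda>\<omega>. (g \<omega>)\<^sup>2)"
  shows "(\<integral>\<omega>. f \<omega> * g \<omega> \<partial>M)\<^sup>2 \<le> (\<integral>\<omega>. (f \<omega>)\<^sup>2 \<partial>M) * (\<integral>\<omega>. (g \<omega>)\<^sup>2 \<partial>M)"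
proof -
  let ?a = "\<integral>\<omega>. (f \<omega>)\<^sup>2 \<partial>M" and ?b = "\<integral>\<omega>. f \<omega> * g \<omega> \<partial>M" and ?c = "\<integral>\<omega>. (g \<omega>)\<^sup>2 \<partial>M"
  note fg = integrable_mult_of_squares[OF m i]
  have q: "0 \<le> x\<^sup>2 * ?a + 2 * x * y * ?b + y\<^sup>2 * ?c" for x y
  proof -
    have "0 \<le> (\<integral>\<omega>. (x * f \<omega> + y * g \<omega>)\<^sup>2 \<partial>M)" by simp
    also have "\<dots> = (\<integral>\<omega>. x\<^sup>2 * (f \<omega>)\<^sup>2 + 2 * x * y * (f \<omega> * g \<omega>) + y\<^sup>2 * (g \<omega>)\<^sup>2 \<partial>M)"
      by (simp add: power2_eq_square algebra_simps)
    also have "\<dots> = x\<^sup>2 * ?a + 2 * x * y * ?b + y\<^sup>2 * ?c"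
      using i fg by simp
    finally show ?thesis .
  qed
  have "0 \<le> ?a" "0 \<le> ?c" by simp_all
  show ?thesis
  proof (cases "?a = 0")
    case True
    have "?b = 0"
    proof (rule ccontr)
      assume "?b \<noteq> 0"
      \<comment> \<open>For \<open>?a = 0\<close> the form at this point equals
        \<open>- ?c - 2\<close>, which is negative.\<close>
      with q[of "- (?c + 1) / ?b" 1] True \<open>0 \<le> ?c\<close> show False by simp
    qed
    then show ?thesis using True by simp
  next
    case False
    then have "?a > 0" using \<open>0 \<le> ?a\<close> by (simp only: less_le) simp
    have "0 \<le> ?a * (?a * ?c - ?b\<^sup>2)"
      using q[of "- ?b" ?a] by (simp add: power2_eq_square algebra_simps)
    then show ?thesis using \<open>?a > 0\<close> by (simp add: zero_le_mult_iff)
  qed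
qed

text \<open>Every second-moment computation below is brought into this shape: products of affine
  expressions in the values at two times, so that only means and covariances remain.\<close>

lemma integral_affine_mult:
  fixes f g :: "'a \<Rightarrow> real"
  assumes P: "prob_space P" and m: "f \<in> borel_measurable P" "g \<in> borel_measurable P"
    and sq: "integrable P (\<lambda>\<omega>. (f \<omega>)\<^sup>2)" "integrable P (\<lambda>\<omega>. (g \<omega>)\<^sup>2)"
  shows "integrable P (\<lambda>\<omega>. (a * f \<omega> + b * g \<omega> + c) * (a' * f \<omega> + b' * g \<omega> + c'))"
    and "(\<integral>\<omega>. (a * f \<omega> + b * g \<omega> + c) * (a' * f \<omega> + b' * g \<omega> + c') \<partial>P) =
      a * a' * (\<integral>\<omega>. f \<omega> * f \<omega> \<partial>P) + (a * b' + b * a') * (\<integral>\<omega>. f \<omega> * g \<omega> \<partial>P)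
      + b * b' * (\<integral>\<omega>. g \<omega> * g \<omega> \<partial>P) + (a * c' + c * a') * (\<integral>\<omega>. f \<omega> \<partial>P)
      + (b * c' + c * b') * (\<integral>\<omega>. g \<omega> \<partial>P) + c * c'"
proof -
  interpret prob_space P by fact
  have eq: "(a * f \<omega> + b * g \<omega> + c) * (a' * f \<omega> + b' * g \<omega> + c') =
      a * a' * (f \<omega> * f \<omega>) + (a * b' + b * a') * (f \<omega> * g \<omega>) + b * b' * (g \<omega> * g \<omega>)
      + (a * c' + c * a') * f \<omega> + (b * c' + c * b') * g \<omega> + c * c'" for \<omega>
    by (simp add: algebra_simps)
  have ints: "integrable P (\<lambda>\<omega>. f \<omega> * f \<omega>)" "integrable P (\<lambda>\<omega>. f \<omega> * g \<omega>)"
    "integrable P (\<lambda>\<omega>. g \<omega> * g \<omega>)" "integrable P f" "integrable P g"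
    using m sq by (auto intro: integrable_mult_of_squares square_integrable_imp_integrable)
  show "integrable P (\<lambda>\<omega>. (a * f \<omega> + b * g \<omega> + c) * (a' * f \<omega> + b' * g \<omega> + c'))"
    unfolding eq using ints by simp
  show "(\<integral>\<omega>. (a * f \<omega> + b * g \<omega> + c) * (a' * f \<omega> + b' * g \<omega> + c') \<partial>P) =
      a * a' * (\<integral>\<omega>. f \<omega> * f \<omega> \<partial>P) + (a * b' + b * a') * (\<integral>\<omega>. f \<omega> * g \<omega> \<partial>P)
      + b * b' * (\<integral>\<omega>. g \<omega> * g \<omega> \<partial>P) + (a * c' + c * a') * (\<integral>\<omega>. f \<omega> \<partial>P)
      + (b * c' + c * b') * (\<integral>\<omega>. g \<omega> \<partial>P) + c * c'"
    unfolding eq using ints by (simp add: prob_space)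
qed

section \<open>Quadratic harnesses\<close>

definition interp :: "real \<Rightarrow> real \<Rightarrow> real \<Rightarrow> real \<Rightarrow> real \<Rightarrow> real" where
  "interp s t u x y = (u - t) / (u - s) * x + (t - s) / (u - s) * y"

lemma open_interval_between:
  assumes "open_interval T" "s \<in> T" "u \<in> T" "s \<le> t" "t \<le> u"
  shows "t \<in> T"
  using assms mem_is_interval_1_I unfolding open_interval_def by blast

text \<open>Names the variance factor \<open>C\<close> that \<open>QH\<close> only asserts to exist,
  so that one fixed function serves all triples of times.\<close>

locale quadratic_harness =
  fixes P :: "'a measure" and T :: "real set" and Z :: "real \<Rightarrow> 'a \<Rightarrow> real"
    and \<eta> \<theta> \<sigma> \<tau> \<gamma> :: real and C :: "real \<Rightarrow> real \<Rightarrow> real \<Rightarrow> real"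
  assumes T_pos: "T \<subseteq> {0<..}"
    and harness: "harness P T (natural_filtration P T Z) Z"
    and square_integrable: "t \<in> T \<Longrightarrow> integrable P (\<lambda>\<omega>. (Z t \<omega>)\<^sup>2)"
    and mean: "t \<in> T \<Longrightarrow> (\<integral>\<omega>. Z t \<omega> \<partial>P) = 0"
    and covariance: "s \<in> T \<Longrightarrow> t \<in> T \<Longrightarrow> (\<integral>\<omega>. Z s \<omega> * Z t \<omega> \<partial>P) = min s t"
    and cond_variance: "s \<in> T \<Longrightarrow> t \<in> T \<Longrightarrow> u \<in> T \<Longrightarrow> s < t \<Longrightarrow> t < u \<Longrightarrow>
      AE \<omega> in P. cond_var P (natural_filtration P T Z s u) (Z t) \<omega> =
        C t s u * qh_K \<eta> \<theta> \<sigma> \<tau> \<gamma>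
          ((Z u \<omega> - Z s \<omega>) / (u - s)) ((u * Z s \<omega> - s * Z u \<omega>) / (u - s))"
begin

abbreviation K_at :: "real \<Rightarrow> real \<Rightarrow> real \<Rightarrow> real \<Rightarrow> real" where
  "K_at s u x y \<equiv> qh_K \<eta> \<theta> \<sigma> \<tau> \<gamma> ((y - x) / (u - s)) ((u * x - s * y) / (u - s))"

text \<open>This is \<open>u - s\<close> times the mean of \<open>K_at s u (Z s) (Z u)\<close>, by
  \<open>integral_K_at\<close>; at \<open>r\<close>, \<open>v\<close> it is the constant
  \<open>D\<close>.\<close>

definition den :: "real \<Rightarrow> real \<Rightarrow> real" where
  "den s u = u * (1 + s * \<sigma>) + \<tau> - s * \<gamma>"

lemma prob_space_P: "prob_space P"
  using harness by (simp add: harness_def stoch_process_def)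

lemma measurable_Z: "t \<in> T \<Longrightarrow> Z t \<in> borel_measurable P"
  using harness by (simp add: harness_def stoch_process_def)

lemma integrable_Z: "t \<in> T \<Longrightarrow> integrable P (Z t)"
  using harness by (simp add: harness_def)

lemma open_interval_T: "open_interval T"
  using harness by (simp add: harness_def)

lemma integral_Z_affine_mult:
  assumes "i \<in> T" "j \<in> T"
  shows "integrable P (\<lambda>\<omega>. (a * Z i \<omega> + b * Z j \<omega> + c) * (a' * Z i \<omega> + b' * Z j \<omega> + c'))"
    and "(\<integral>\<omega>. (a * Z i \<omega> + b * Z j \<omega> + c) * (a' * Z i \<omega> + b' * Z j \<omega> + c') \<partial>P) =
      a * a' * i + (a * b' + b * a') * min i j + b * b' * j + c * c'"
  using integral_affine_mult[OF prob_space_P measurable_Z measurable_Z square_integrable square_integrable,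
      OF assms(1) assms(2) assms(1) assms(2), of a b c a' b' c']
  by (simp_all add: mean covariance assms)

context
  fixes s t u :: real
  assumes T: "s \<in> T" "t \<in> T" "u \<in> T" and less: "s < t" "t < u"
begin

lemma sigma_finite_nat: "sigma_finite_subalgebra P (natural_filtration P T Z s u)"
  unfolding natural_filtration_def
  by (rule sigma_finite_process_sigma[OF prob_space_P]) (auto intro: measurable_Z)

lemma cond_exp_nat:
  "AE \<omega> in P. real_cond_exp P (natural_filtration P T Z s u) (Z t) \<omega> = interp s t u (Z s \<omega>) (Z u \<omega>)"
  using harness T less by (auto simp: harness_def interp_def)

lemma measurable_interp_nat:
  "(\<lambda>\<omega>. interp s t u (Z s \<omega>) (Z u \<omega>)) \<in> borel_measurable (natural_filtration P T Z s u)"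
proof -
  have [measurable]: "Z s \<in> borel_measurable (natural_filtration P T Z s u)"
    "Z u \<in> borel_measurable (natural_filtration P T Z s u)"
    unfolding natural_filtration_def using T by (auto intro: measurable_process_sigma)
  show ?thesis unfolding interp_def by measurable
qed

text \<open>The linear terms have mean zero. With covariance \<open>min\<close>, the slope has
  variance \<open>1 / (u - s)\<close>, the intercept \<open>u * s / (u - s)\<close>, and their
  covariance is \<open>- s / (u - s)\<close>.\<close>

lemma integrable_K_at: "integrable P (\<lambda>\<omega>. K_at s u (Z s \<omega>) (Z u \<omega>))"
  and integral_K_at: "(\<integral>\<omega>. K_at s u (Z s \<omega>) (Z u \<omega>) \<partial>P) * (u - s) = den s u"
proof -
  have us: "u - s > 0" using less by simp
  \<comment> \<open>Writing the reciprocal as an atom keeps the algebra polynomial; its meaning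
    enters only through \<open>w1\<close>.\<close>
  define w where "w = 1 / (u - s)"
  have w: "x / (u - s) = w * x" for x by (simp add: w_def)
  have w1: "w * (u - s) = 1" using us by (simp add: w_def)
  interpret prob_space P by (rule prob_space_P)
  \<comment> \<open>The linear terms are padded with a constant factor 1, so that all terms are
    products of two affine expressions.\<close>
  have eq: "K_at s u (Z s \<omega>) (Z u \<omega>) =
     1 + \<eta> * ((0 * Z s \<omega> + 0 * Z u \<omega> + 1) * ((w * u) * Z s \<omega> + (- w * s) * Z u \<omega> + 0))
     + \<theta> * ((0 * Z s \<omega> + 0 * Z u \<omega> + 1) * ((- w) * Z s \<omega> + w * Z u \<omega> + 0))
     + \<sigma> * (((w * u) * Z s \<omega> + (- w * s) * Z u \<omega> + 0) * ((w * u) * Z s \<omega> + (- w * s) * Z u \<omega> + 0))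
     + \<tau> * (((- w) * Z s \<omega> + w * Z u \<omega> + 0) * ((- w) * Z s \<omega> + w * Z u \<omega> + 0))
     - (1 - \<gamma>) * (((- w) * Z s \<omega> + w * Z u \<omega> + 0) * ((w * u) * Z s \<omega> + (- w * s) * Z u \<omega> + 0))" for \<omega>
    unfolding qh_K_def w by (simp add: power2_eq_square algebra_simps)
  note ints = integral_Z_affine_mult(1)[OF T(1) T(3)]
  show "integrable P (\<lambda>\<omega>. K_at s u (Z s \<omega>) (Z u \<omega>))"
    unfolding eq by (intro Bochner_Integration.integrable_add Bochner_Integration.integrable_diff
        integrable_mult_right ints) simp
  have "(\<integral>\<omega>. K_at s u (Z s \<omega>) (Z u \<omega>) \<partial>P) =
     1 + \<sigma> * (w * u * (w * u) * s + (w * u * (- w * s) + (- w * s) * (w * u)) * s + (- w * s) * (- w * s) * u)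
     + \<tau> * (w * w * s - 2 * w * w * s + w * w * u)
     - (1 - \<gamma>) * ((- w) * (w * u) * s + ((- w) * (- w * s) + w * (w * u)) * s + w * (- w * s) * u)"
    unfolding eq using less
    by (simp only: Bochner_Integration.integral_add Bochner_Integration.integral_diff
        Bochner_Integration.integrable_add Bochner_Integration.integrable_diff
        integral_mult_right_zero integrable_mult_right ints integral_Z_affine_mult(2)[OF T(1) T(3)]
        integrable_const lebesgue_integral_const) (simp add: prob_space algebra_simps)
  also have "\<dots> = 1 + w * (w * (u - s)) * (\<sigma> * u * s + \<tau> + (1 - \<gamma>) * s)"
    by (simp add: algebra_simps)
  also have "\<dots> * (u - s) = (u - s) + (w * (u - s)) * (w * (u - s)) * (\<sigma> * u * s + \<tau> + (1 - \<gamma>) * s)"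
    by (simp add: algebra_simps)
  also have "\<dots> = den s u" unfolding w1 den_def by (simp add: algebra_simps)
  finally show "(\<integral>\<omega>. K_at s u (Z s \<omega>) (Z u \<omega>) \<partial>P) * (u - s) = den s u" .
qed

lemma integrable_interp_shift_sq:
  "integrable P (\<lambda>\<omega>. (interp s t u (Z s \<omega>) (Z u \<omega>) - a)\<^sup>2)"
  using integral_Z_affine_mult(1)[OF T(1) T(3), of "(u - t) / (u - s)" "(t - s) / (u - s)" "- a"
    "(u - t) / (u - s)" "(t - s) / (u - s)" "- a"]
  by (simp add: interp_def power2_eq_square)

lemma integrable_Z_shift_sq: "integrable P (\<lambda>\<omega>. (Z t \<omega> - a)\<^sup>2)"
  using integral_Z_affine_mult(1)[OF T(2) T(3), of 1 0 "- a" 1 0 "- a"]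
  by (simp add: power2_eq_square)

text \<open>With \<open>L\<close> the interpolation, \<open>(Z t - a)\<^sup>2\<close> splits into
  \<open>(Z t - L)\<^sup>2\<close>, a cross term of conditional mean zero, and
  \<open>(L - a)\<^sup>2\<close>. This form is needed because a bridge inherits conditional
  expectations of fixed functions of \<open>Z t\<close>, while the square in the conditional
  variance also involves \<open>L\<close>.\<close>

lemma cond_exp_shift_sq_nat:
  "AE \<omega> in P. real_cond_exp P (natural_filtration P T Z s u) (\<lambda>\<omega>. (Z t \<omega> - a)\<^sup>2) \<omega> =
     (interp s t u (Z s \<omega>) (Z u \<omega>) - a)\<^sup>2 + C t s u * K_at s u (Z s \<omega>) (Z u \<omega>)"
proof -
  let ?G = "natural_filtration P T Z s u"
  let ?L = "\<lambda>\<omega>. interp s t u (Z s \<omega>) (Z u \<omega>)"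
  interpret prob_space P by (rule prob_space_P)
  interpret sigma_finite_subalgebra P ?G by (rule sigma_finite_nat)
  note measurable_interp_nat[measurable]
  have [measurable]: "?L \<in> borel_measurable P"
    using measurable_interp_nat subalg measurable_from_subalg by blast
  note [measurable] = measurable_Z[OF T(2)]
  have L2: "integrable P (\<lambda>\<omega>. (?L \<omega> - a)\<^sup>2)" by (rule integrable_interp_shift_sq)
  have L1: "integrable P ?L" unfolding interp_def using integrable_Z T by simp
  have ZL: "integrable P (\<lambda>\<omega>. (Z t \<omega> - ?L \<omega>)\<^sup>2)"
  proof -
    have "integrable P (\<lambda>\<omega>. Z t \<omega> * ?L \<omega>)"
      using integrable_interp_shift_sq[of 0] square_integrable[OF T(2)]
      by (intro integrable_mult_of_squares) simp_all
    then have "integrable P (\<lambda>\<omega>. (Z t \<omega>)\<^sup>2 + (?L \<omega>)\<^sup>2 - 2 * (Z t \<omega> * ?L \<omega>))"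
      using integrable_interp_shift_sq[of 0] square_integrable[OF T(2)] by simp
    then show ?thesis by (simp add: power2_diff mult.assoc)
  qed
  have cross: "integrable P (\<lambda>\<omega>. (2 * (?L \<omega> - a)) * (Z t \<omega> - ?L \<omega>))"
    unfolding mult.assoc by (intro integrable_mult_right integrable_mult_of_squares L2 ZL) simp_all
  have "AE \<omega> in P. real_cond_exp P ?G (\<lambda>\<omega>. (Z t \<omega> - real_cond_exp P ?G (Z t) \<omega>)\<^sup>2) \<omega> =
      real_cond_exp P ?G (\<lambda>\<omega>. (Z t \<omega> - ?L \<omega>)\<^sup>2) \<omega>"
    using cond_exp_nat by (intro real_cond_exp_cong) auto
  moreover have "AE \<omega> in P. real_cond_exp P ?G (\<lambda>\<omega>. (2 * (?L \<omega> - a)) * (Z t \<omega> - ?L \<omega>)) \<omega> =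
      (2 * (?L \<omega> - a)) * real_cond_exp P ?G (\<lambda>\<omega>. Z t \<omega> - ?L \<omega>) \<omega>"
    using cross by (intro real_cond_exp_mult) auto
  moreover have "AE \<omega> in P. real_cond_exp P ?G (\<lambda>\<omega>. Z t \<omega> - ?L \<omega>) \<omega> =
      real_cond_exp P ?G (Z t) \<omega> - real_cond_exp P ?G ?L \<omega>"
    using L1 integrable_Z T by (intro real_cond_exp_diff) auto
  moreover have "AE \<omega> in P. real_cond_exp P ?G ?L \<omega> = ?L \<omega>"
    using L1 by (intro real_cond_exp_F_meas) auto
  moreover have "AE \<omega> in P. real_cond_exp P ?G (\<lambda>\<omega>. (?L \<omega> - a)\<^sup>2) \<omega> = (?L \<omega> - a)\<^sup>2"
    using L2 by (intro real_cond_exp_F_meas) auto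
  moreover have "AE \<omega> in P. real_cond_exp P ?G (\<lambda>\<omega>. ((Z t \<omega> - ?L \<omega>)\<^sup>2 +
        (2 * (?L \<omega> - a)) * (Z t \<omega> - ?L \<omega>)) + (?L \<omega> - a)\<^sup>2) \<omega> =
      real_cond_exp P ?G (\<lambda>\<omega>. (Z t \<omega> - ?L \<omega>)\<^sup>2 + (2 * (?L \<omega> - a)) * (Z t \<omega> - ?L \<omega>)) \<omega> +
      real_cond_exp P ?G (\<lambda>\<omega>. (?L \<omega> - a)\<^sup>2) \<omega>"
    using L2 ZL cross by (intro real_cond_exp_add) auto
  moreover have "AE \<omega> in P. real_cond_exp P ?G (\<lambda>\<omega>. (Z t \<omega> - ?L \<omega>)\<^sup>2 +
        (2 * (?L \<omega> - a)) * (Z t \<omega> - ?L \<omega>)) \<omega> =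
      real_cond_exp P ?G (\<lambda>\<omega>. (Z t \<omega> - ?L \<omega>)\<^sup>2) \<omega> +
      real_cond_exp P ?G (\<lambda>\<omega>. (2 * (?L \<omega> - a)) * (Z t \<omega> - ?L \<omega>)) \<omega>"
    using ZL cross by (intro real_cond_exp_add) auto
  moreover have "(\<lambda>\<omega>. ((Z t \<omega> - ?L \<omega>)\<^sup>2 + (2 * (?L \<omega> - a)) * (Z t \<omega> - ?L \<omega>)) + (?L \<omega> - a)\<^sup>2) =
      (\<lambda>\<omega>. (Z t \<omega> - a)\<^sup>2)"
    by (simp add: fun_eq_iff power2_eq_square algebra_simps)
  ultimately show ?thesis
    using cond_exp_nat cond_variance[OF T less] unfolding cond_var_def
    by (elim AE_mp) (auto intro!: AE_I2)
qed

text \<open>Total variance: subtracting the second moment of the interpolation from \<open>t\<close>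
  leaves \<open>(t - s) * (u - t) / (u - s)\<close>, the Brownian bridge variance. This must equal
  \<open>C t s u\<close> times the mean of \<open>K_at\<close>, which is
  \<open>den s u / (u - s)\<close>.\<close>

lemma C_mult_den: "C t s u * den s u = (t - s) * (u - t)"
proof -
  let ?G = "natural_filtration P T Z s u"
  let ?L = "\<lambda>\<omega>. interp s t u (Z s \<omega>) (Z u \<omega>)"
  interpret prob_space P by (rule prob_space_P)
  interpret sigma_finite_subalgebra P ?G by (rule sigma_finite_nat)
  have us: "u - s > 0" using less by simp
  define w where "w = 1 / (u - s)"
  have w1: "w * (u - s) = 1" using us by (simp add: w_def)
  have sq: "integrable P (\<lambda>\<omega>. (Z t \<omega> - 0)\<^sup>2)" by (rule integrable_Z_shift_sq)
  have "t = (\<integral>\<omega>. (Z t \<omega> - 0)\<^sup>2 \<partial>P)"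
    using covariance[OF T(2) T(2)] by (simp add: power2_eq_square)
  also have "\<dots> = (\<integral>\<omega>. real_cond_exp P ?G (\<lambda>\<omega>. (Z t \<omega> - 0)\<^sup>2) \<omega> \<partial>P)"
    using real_cond_exp_int(2)[OF sq] by simp
  also have "\<dots> = (\<integral>\<omega>. (?L \<omega> - 0)\<^sup>2 + C t s u * K_at s u (Z s \<omega>) (Z u \<omega>) \<partial>P)"
    using cond_exp_shift_sq_nat[of 0] integrable_interp_shift_sq[of 0] integrable_K_at
    by (intro integral_cong_AE) (auto intro!: borel_measurable_integrable)
  also have "\<dots> = (\<integral>\<omega>. (?L \<omega> - 0)\<^sup>2 \<partial>P) + C t s u * (\<integral>\<omega>. K_at s u (Z s \<omega>) (Z u \<omega>) \<partial>P)"
    using integrable_interp_shift_sq[of 0] integrable_K_at by simp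
  also have "(\<integral>\<omega>. (?L \<omega> - 0)\<^sup>2 \<partial>P) = (w * (u - t)) * (w * (u - t)) * s
      + 2 * (w * (u - t)) * (w * (t - s)) * s + (w * (t - s)) * (w * (t - s)) * u"
    using integral_Z_affine_mult(2)[OF T(1) T(3), of "w * (u - t)" "w * (t - s)" 0 "w * (u - t)" "w * (t - s)" 0] less
    by (simp add: interp_def power2_eq_square w_def)
  finally have *: "t = (w * (u - t)) * (w * (u - t)) * s
      + 2 * (w * (u - t)) * (w * (t - s)) * s + (w * (t - s)) * (w * (t - s)) * u +
      C t s u * (\<integral>\<omega>. K_at s u (Z s \<omega>) (Z u \<omega>) \<partial>P)" .
  have "t * (u - s) = ((w * (u - t)) * (w * (u - t)) * s
      + 2 * (w * (u - t)) * (w * (t - s)) * s + (w * (t - s)) * (w * (t - s)) * u) * (u - s) +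
      C t s u * ((\<integral>\<omega>. K_at s u (Z s \<omega>) (Z u \<omega>) \<partial>P) * (u - s))"
    using arg_cong[OF *, of "\<lambda>x. x * (u - s)"] by (simp only: distrib_right mult.assoc)
  also have "\<dots> = (w * (u - s)) * (w * ((u - t) * (u - t) * s + 2 * (u - t) * (t - s) * s
      + (t - s) * (t - s) * u)) + C t s u * den s u"
    unfolding integral_K_at by (simp add: algebra_simps)
  also have "(u - t) * (u - t) * s + 2 * (u - t) * (t - s) * s + (t - s) * (t - s) * u =
      (u - s) * (s * (u - s) + (t - s) * (t - s))"
    by (simp add: algebra_simps)
  also have "w * ((u - s) * (s * (u - s) + (t - s) * (t - s))) = s * (u - s) + (t - s) * (t - s)"
    using w1 by (simp flip: mult.assoc)
  finally show ?thesis unfolding w1 by (simp add: algebra_simps)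
qed

text \<open>Nonnegativity of the conditional variance, restated for the pair
  \<open>(Z s, Z u)\<close> alone so that absolute continuity can carry it over to the
  bridge.\<close>

lemma C_K_at_nonneg: "AE \<omega> in P. 0 \<le> C t s u * K_at s u (Z s \<omega>) (Z u \<omega>)"
proof -
  let ?G = "natural_filtration P T Z s u"
  interpret sigma_finite_subalgebra P ?G by (rule sigma_finite_nat)
  have "AE \<omega> in P. 0 \<le> cond_var P ?G (Z t) \<omega>"
    unfolding cond_var_def using measurable_Z[OF T(2)]
    by (intro real_cond_exp_pos) auto
  then show ?thesis using cond_variance[OF T less] by eventually_elim simp
qed

end

text \<open>Tower property: the formula for the full past and future depends on \<open>Z s\<close>
  and \<open>Z u\<close> only, so it persists for every smaller sigma-field that still contains
  these two. The bridge property needs finitely many conditioning times.\<close>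

lemma cond_exp_finite:
  assumes I: "finite I" "I \<subseteq> T" "s \<in> I" "u \<in> I" "\<And>i. i \<in> I \<Longrightarrow> i \<le> s \<or> u \<le> i"
    and f: "integrable P f"
    and h: "(\<lambda>x. h (fst x) (snd x)) \<in> borel_measurable (borel \<Otimes>\<^sub>M borel)"
      "integrable P (\<lambda>\<omega>. h (Z s \<omega>) (Z u \<omega>))"
    and ce: "AE \<omega> in P. real_cond_exp P (natural_filtration P T Z s u) f \<omega> = h (Z s \<omega>) (Z u \<omega>)"
  shows "AE \<omega> in P. real_cond_exp P (process_sigma P Z I) f \<omega> = h (Z s \<omega>) (Z u \<omega>)"
proof -
  let ?G = "natural_filtration P T Z s u"
  interpret sigma_finite_subalgebra P "process_sigma P Z I"
    by (rule sigma_finite_process_sigma[OF prob_space_P]) (use I measurable_Z in auto)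
  have PG: "subalgebra P ?G" unfolding natural_filtration_def
    by (intro subalgebra_process_sigma) (auto intro: measurable_Z)
  have GI: "subalgebra ?G (process_sigma P Z I)" unfolding natural_filtration_def
    using I by (intro process_sigma_subalgebra_mono) auto
  have hm: "(\<lambda>\<omega>. h (Z s \<omega>) (Z u \<omega>)) \<in> borel_measurable (process_sigma P Z I)"
    using measurable_compose[OF measurable_Pair[OF measurable_process_sigma[OF I(3)] measurable_process_sigma[OF I(4)]] h(1)]
    by simp
  have "AE \<omega> in P. real_cond_exp P (process_sigma P Z I) (real_cond_exp P ?G f) \<omega> =
      real_cond_exp P (process_sigma P Z I) f \<omega>"
    by (rule real_cond_exp_nested_subalg[OF PG GI f])
  moreover have "AE \<omega> in P. real_cond_exp P (process_sigma P Z I) (real_cond_exp P ?G f) \<omega> =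
      real_cond_exp P (process_sigma P Z I) (\<lambda>\<omega>. h (Z s \<omega>) (Z u \<omega>)) \<omega>"
    using h ce by (intro real_cond_exp_cong) auto
  moreover have "AE \<omega> in P. real_cond_exp P (process_sigma P Z I) (\<lambda>\<omega>. h (Z s \<omega>) (Z u \<omega>)) \<omega> =
      h (Z s \<omega>) (Z u \<omega>)"
    using h(2) hm by (rule real_cond_exp_F_meas)
  ultimately show ?thesis by eventually_elim simp
qed

end

section \<open>Bridges of quadratic harnesses\<close>

text \<open>The conditional second moment minus the square of the conditional mean. It leads back
  from transferred second moments to a conditional variance.\<close>

lemma cond_var_eqI:
  assumes P: "prob_space P" and G: "subalgebra P G"
    and Y: "Y \<in> borel_measurable P" "integrable P (\<lambda>\<omega>. (Y \<omega>)\<^sup>2)"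
    and L: "L \<in> borel_measurable G" "integrable P (\<lambda>\<omega>. (L \<omega>)\<^sup>2)"
    and ce: "AE \<omega> in P. real_cond_exp P G Y \<omega> = L \<omega>"
    and ce2: "AE \<omega> in P. real_cond_exp P G (\<lambda>\<omega>. (Y \<omega>)\<^sup>2) \<omega> = (L \<omega>)\<^sup>2 + k \<omega>"
  shows "AE \<omega> in P. cond_var P G Y \<omega> = k \<omega>"
proof -
  interpret prob_space P by fact
  interpret finite_measure_subalgebra P G by unfold_locales (rule G)
  note [measurable] = Y(1) L(1)
  have [measurable]: "L \<in> borel_measurable P" by (rule measurable_from_subalg[OF G L(1)])
  have LY: "integrable P (\<lambda>\<omega>. L \<omega> * Y \<omega>)"
    by (rule integrable_mult_of_squares) (use Y L in auto)
  then have LY2: "integrable P (\<lambda>\<omega>. (2 * L \<omega>) * Y \<omega>)" by (simp add: mult.assoc)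
  have "AE \<omega> in P. real_cond_exp P G (\<lambda>\<omega>. (Y \<omega> - real_cond_exp P G Y \<omega>)\<^sup>2) \<omega> =
      real_cond_exp P G (\<lambda>\<omega>. ((Y \<omega>)\<^sup>2 - (2 * L \<omega>) * Y \<omega>) + (L \<omega>)\<^sup>2) \<omega>"
    using ce by (intro real_cond_exp_cong) (auto simp: power2_diff algebra_simps)
  moreover have "AE \<omega> in P. real_cond_exp P G (\<lambda>\<omega>. ((Y \<omega>)\<^sup>2 - (2 * L \<omega>) * Y \<omega>) + (L \<omega>)\<^sup>2) \<omega> =
      real_cond_exp P G (\<lambda>\<omega>. (Y \<omega>)\<^sup>2 - (2 * L \<omega>) * Y \<omega>) \<omega> + real_cond_exp P G (\<lambda>\<omega>. (L \<omega>)\<^sup>2) \<omega>"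
    using Y L LY2 by (intro real_cond_exp_add) auto
  moreover have "AE \<omega> in P. real_cond_exp P G (\<lambda>\<omega>. (Y \<omega>)\<^sup>2 - (2 * L \<omega>) * Y \<omega>) \<omega> =
      real_cond_exp P G (\<lambda>\<omega>. (Y \<omega>)\<^sup>2) \<omega> - real_cond_exp P G (\<lambda>\<omega>. (2 * L \<omega>) * Y \<omega>) \<omega>"
    using Y LY2 by (intro real_cond_exp_diff) auto
  moreover have "AE \<omega> in P. real_cond_exp P G (\<lambda>\<omega>. (2 * L \<omega>) * Y \<omega>) \<omega> = (2 * L \<omega>) * real_cond_exp P G Y \<omega>"
    using LY2 by (intro real_cond_exp_mult) auto
  moreover have "AE \<omega> in P. real_cond_exp P G (\<lambda>\<omega>. (L \<omega>)\<^sup>2) \<omega> = (L \<omega>)\<^sup>2"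
    using L by (intro real_cond_exp_F_meas) auto
  ultimately show ?thesis
    using ce ce2 unfolding cond_var_def
    by eventually_elim (simp add: power2_eq_square)
qed

locale quadratic_harness_bridge = quadratic_harness P T Z \<eta> \<theta> \<sigma> \<tau> \<gamma> C
  for P :: "'a measure" and T Z \<eta> \<theta> \<sigma> \<tau> \<gamma> C +
  fixes Q :: "'b measure" and X :: "real \<Rightarrow> 'b \<Rightarrow> real" and r v z\<^sub>r z\<^sub>v :: real
  assumes r_T: "r \<in> T" and v_T: "v \<in> T" and r_less_v: "r < v"
    and bridge: "bridge P T Z r z\<^sub>r v z\<^sub>v Q X"
    and K_pos: "K_at r v z\<^sub>r z\<^sub>v > 0"
begin

definition line :: "real \<Rightarrow> real" where "line t = interp r t v z\<^sub>r z\<^sub>v"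

text \<open>The limit of the conditional second moments of \<open>X t\<close> about the chord. It is
  first an upper bound for the unconditional one and in the end, by \<open>q_diag\<close>, its
  value.\<close>

definition bridge_var :: "real \<Rightarrow> real" where
  "bridge_var t = (t - r) * (v - t) / den r v * K_at r v z\<^sub>r z\<^sub>v"

lemma in_T: "r < t \<Longrightarrow> t < v \<Longrightarrow> t \<in> T"
  using open_interval_between[OF open_interval_T r_T v_T] by simp

lemma prob_space_Q: "prob_space Q"
  using bridge by (simp add: bridge_def stoch_process_def)

lemma measurable_X: "r < t \<Longrightarrow> t < v \<Longrightarrow> X t \<in> borel_measurable Q"
  using bridge by (simp add: bridge_def stoch_process_def)

lemma sigma_finite_X: "I \<subseteq> {r<..<v} \<Longrightarrow> sigma_finite_subalgebra Q (process_sigma Q X I)"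
  by (rule sigma_finite_process_sigma[OF prob_space_Q], rule measurable_X) auto

lemma den_neq_0: "s \<in> T \<Longrightarrow> t \<in> T \<Longrightarrow> u \<in> T \<Longrightarrow> s < t \<Longrightarrow> t < u \<Longrightarrow> den s u \<noteq> 0"
  and C_eq: "s \<in> T \<Longrightarrow> t \<in> T \<Longrightarrow> u \<in> T \<Longrightarrow> s < t \<Longrightarrow> t < u \<Longrightarrow>
    C t s u = (t - s) * (u - t) / den s u"
proof -
  assume T: "s \<in> T" "t \<in> T" "u \<in> T" and less: "s < t" "t < u"
  have eq: "C t s u * den s u = (t - s) * (u - t)" by (rule C_mult_den[OF T less])
  have pos: "0 < (t - s) * (u - t)" using less by simp
  from eq pos show nz: "den s u \<noteq> 0" by force
  from eq nz show "C t s u = (t - s) * (u - t) / den s u" by (simp add: eq_divide_eq)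
qed

text \<open>The conditional-expectation clause of \<open>bridge\<close> for one intermediate time
  \<open>t\<close>, with the conditioning times split into those up to \<open>s\<close> and those
  from \<open>u\<close> on.\<close>

lemma cond_exp_transfer:
  assumes I: "finite I" "I \<subseteq> {r<..<v}" "s \<in> I" "u \<in> I" "\<And>i. i \<in> I \<Longrightarrow> i \<le> s \<or> u \<le> i"
    and t: "s < t" "t < u"
    and g: "g \<in> borel_measurable borel" "integrable P (\<lambda>\<omega>. g (Z t \<omega>))"
    and h: "(\<lambda>x. h (fst x) (snd x)) \<in> borel_measurable (borel \<Otimes>\<^sub>M borel)"
      "integrable P (\<lambda>\<omega>. h (Z s \<omega>) (Z u \<omega>))"
    and ce: "AE \<omega> in P. real_cond_exp P (natural_filtration P T Z s u) (\<lambda>\<omega>. g (Z t \<omega>)) \<omega> =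
      h (Z s \<omega>) (Z u \<omega>)"
  shows "ext_cond_exp_is Q (process_sigma Q X I) (\<lambda>\<omega>. g (X t \<omega>)) (\<lambda>\<omega>. h (X s \<omega>) (X u \<omega>))"
proof -
  define S where "S = {i \<in> I. i \<le> s}"
  define U where "U = {i \<in> I. u \<le> i}"
  have SU: "S \<union> U = I" using I(5) by (auto simp: S_def U_def)
  have su: "s \<in> S \<union> U" "u \<in> S \<union> U" using SU I by auto
  have rv: "r < s" "u < v" using I by auto
  have g': "(\<lambda>x. g (x t)) \<in> borel_measurable (Pi\<^sub>M {t} (\<lambda>_. borel))"
    using measurable_compose[OF measurable_component_singleton[of t "{t}" "\<lambda>_. borel"] g(1)] by simp
  have h': "(\<lambda>x. h (x s) (x u)) \<in> borel_measurable (Pi\<^sub>M (S \<union> U) (\<lambda>_. borel))"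
    using measurable_compose[OF measurable_Pair[OF
      measurable_component_singleton[OF su(1), of "\<lambda>_. borel"]
      measurable_component_singleton[OF su(2), of "\<lambda>_. borel"]] h(1)] by simp
  have IT: "I \<subseteq> T" using I(2) in_T by auto
  have ce': "AE \<omega> in P. real_cond_exp P (process_sigma P Z I) (\<lambda>\<omega>. g (Z t \<omega>)) \<omega> = h (Z s \<omega>) (Z u \<omega>)"
    by (rule cond_exp_finite[OF I(1) IT I(3-5) g(2) h ce])
  have "finite S \<and> finite {t} \<and> finite U \<and> S \<noteq> {} \<and> {t} \<noteq> {} \<and> U \<noteq> {} \<and>
      S \<subseteq> {r<..<v} \<and> {t} \<subseteq> {r<..<v} \<and> U \<subseteq> {r<..<v} \<and>
      (\<forall>s\<in>S. \<forall>t\<in>{t}. s < t) \<and> (\<forall>t\<in>{t}. \<forall>u\<in>U. t < u)"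
    using I(1-4) t rv unfolding S_def U_def by auto
  \<comment> \<open>Selects the last conjunct of \<open>bridge\<close>, at the sets
    \<open>S\<close>, \<open>{t}\<close> and \<open>U\<close>.\<close>
  note tr = bridge[unfolded bridge_def, THEN conjunct2, THEN conjunct2, THEN conjunct2, THEN conjunct2,
    THEN conjunct2, THEN conjunct2, THEN conjunct2,
    THEN spec[of _ S], THEN spec[of _ "{t}"], THEN spec[of _ U], THEN mp, OF this]
  have "ext_cond_exp_is Q (process_sigma Q X (S \<union> U))
     (\<lambda>\<omega>. g (proc_vec X {t} \<omega> t)) (\<lambda>\<omega>. h (proc_vec X (S \<union> U) \<omega> s) (proc_vec X (S \<union> U) \<omega> u))"
    using tr[THEN bspec, OF g', THEN bspec, OF h'] g(2) ce' I(3,4) by (simp add: proc_vec_def SU)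
  then show ?thesis using I(3,4) by (simp add: proc_vec_def SU)
qed

text \<open>Stated in the extended sense, since integrability of \<open>X t\<close> is not yet
  available.\<close>

lemma cond_exp_X_finite:
  assumes I: "finite I" "I \<subseteq> {r<..<v}" "s \<in> I" "u \<in> I" "\<And>i. i \<in> I \<Longrightarrow> i \<le> s \<or> u \<le> i"
    and t: "s < t" "t < u"
  shows "ext_cond_exp_is Q (process_sigma Q X I) (X t) (\<lambda>\<omega>. interp s t u (X s \<omega>) (X u \<omega>))"
    and "ext_cond_exp_is Q (process_sigma Q X I) (\<lambda>\<omega>. (X t \<omega> - a)\<^sup>2)
      (\<lambda>\<omega>. (interp s t u (X s \<omega>) (X u \<omega>) - a)\<^sup>2 + C t s u * K_at s u (X s \<omega>) (X u \<omega>))"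
proof -
  have T: "s \<in> T" "t \<in> T" "u \<in> T" using I t by (auto intro!: in_T)
  show "ext_cond_exp_is Q (process_sigma Q X I) (X t) (\<lambda>\<omega>. interp s t u (X s \<omega>) (X u \<omega>))"
    using integrable_Z[OF T(1)] integrable_Z[OF T(2)] integrable_Z[OF T(3)] cond_exp_nat[OF T t]
    by (intro cond_exp_transfer[OF I t, where g = "\<lambda>x. x"]) (simp_all add: interp_def)
  show "ext_cond_exp_is Q (process_sigma Q X I) (\<lambda>\<omega>. (X t \<omega> - a)\<^sup>2)
      (\<lambda>\<omega>. (interp s t u (X s \<omega>) (X u \<omega>) - a)\<^sup>2 + C t s u * K_at s u (X s \<omega>) (X u \<omega>))"
  proof (rule cond_exp_transfer[OF I t, where g = "\<lambda>x. (x - a)\<^sup>2"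
        and h = "\<lambda>x y. (interp s t u x y - a)\<^sup>2 + C t s u * K_at s u x y"])
    show "integrable P (\<lambda>\<omega>. (interp s t u (Z s \<omega>) (Z u \<omega>) - a)\<^sup>2 + C t s u * K_at s u (Z s \<omega>) (Z u \<omega>))"
      using integrable_interp_shift_sq[OF T t, of a] integrable_K_at[OF T t] by simp
    show "(\<lambda>x. (interp s t u (fst x) (snd x) - a)\<^sup>2 + C t s u * K_at s u (fst x) (snd x))
        \<in> borel_measurable (borel \<Otimes>\<^sub>M borel)"
      unfolding interp_def qh_K_def by measurable
  qed (rule integrable_Z_shift_sq[OF T t] cond_exp_shift_sq_nat[OF T t] | simp)+
qed

text \<open>The inequality defines a measurable set of full measure under the law of
  \<open>(Z s, Z u)\<close>; its complement is null under the law of \<open>(X s, X u)\<close> too,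
  by absolute continuity.\<close>

lemma C_K_at_X_nonneg:
  assumes "r < s" "s < t" "t < u" "u < v"
  shows "AE \<omega> in Q. 0 \<le> C t s u * K_at s u (X s \<omega>) (X u \<omega>)"
proof -
  have T: "s \<in> T" "t \<in> T" "u \<in> T" using assms by (auto intro!: in_T)
  let ?M = "Pi\<^sub>M {s, u} (\<lambda>_. borel :: real measure)"
  have Zm: "proc_vec Z {s, u} \<in> measurable P ?M"
    by (rule measurable_proc_vec) (use T measurable_Z in auto)
  have Xm: "proc_vec X {s, u} \<in> measurable Q ?M"
    by (rule measurable_proc_vec) (use assms measurable_X in auto)
  have su: "s \<in> {s, u}" "u \<in> {s, u}" by auto
  note [measurable] = measurable_component_singleton[OF su(1), of "\<lambda>_. borel"]
    measurable_component_singleton[OF su(2), of "\<lambda>_. borel"]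
  have "(\<lambda>x. C t s u * K_at s u (x s) (x u)) \<in> borel_measurable ?M"
    unfolding qh_K_def by measurable
  then have B: "{x \<in> space ?M. 0 \<le> C t s u * K_at s u (x s) (x u)} \<in> sets ?M"
    by measurable
  have "AE x in distr P ?M (proc_vec Z {s, u}). 0 \<le> C t s u * K_at s u (x s) (x u)"
    using C_K_at_nonneg[OF T assms(2,3)] by (subst AE_distr_iff[OF Zm B]) (simp add: proc_vec_def)
  moreover have "{s, u} \<subseteq> {r<..<v}" using assms by auto
  then have "finite {s, u} \<and> {s, u} \<noteq> {} \<and> {s, u} \<subseteq> {r<..<v}" by blast
  note bridge[unfolded bridge_def, THEN conjunct2, THEN conjunct2, THEN conjunct2,
    THEN conjunct2, THEN conjunct2, THEN conjunct2, THEN conjunct1, THEN spec[of _ "{s, u}"], THEN mp, OF this]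
  ultimately have "AE x in distr Q ?M (proc_vec X {s, u}). 0 \<le> C t s u * K_at s u (x s) (x u)"
    using absolutely_continuous_AE[of "distr Q ?M (proc_vec X {s, u})" "distr P ?M (proc_vec Z {s, u})"]
    by (simp only: sets_distr)
  then show ?thesis
    by (subst (asm) AE_distr_iff[OF Xm B]) (simp add: proc_vec_def)
qed

section \<open>Conditioning times tending to the end points\<close>

text \<open>The requirement that the times be within \<open>1 / (n + 1)\<close> of their end points
  goes into the predicates \<open>R\<close>, which forces the sequences themselves to converge. The
  time \<open>t\<close> keeps them on its two sides.\<close>

lemma endpoint_sequences:
  assumes t: "r < t" "t < v"
  obtains s u :: "nat \<Rightarrow> real" where "\<And>n. r < s n" "\<And>n. s n < t" "s \<longlonglongrightarrow> r"
    "\<And>n. t < u n" "\<And>n. u n < v" "u \<longlonglongrightarrow> v"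
    "AE \<omega> in Q. (\<lambda>n. X (s n) \<omega>) \<longlonglongrightarrow> z\<^sub>r" "AE \<omega> in Q. (\<lambda>n. X (u n) \<omega>) \<longlonglongrightarrow> z\<^sub>v"
proof -
  define \<epsilon> where "\<epsilon> n = 1 / real (Suc n)" for n
  have \<epsilon>: "\<epsilon> n > 0" for n by (simp add: \<epsilon>_def)
  have \<epsilon>0: "\<epsilon> \<longlonglongrightarrow> 0" unfolding \<epsilon>_def using LIMSEQ_inverse_real_of_nat by (simp add: inverse_eq_divide)
  have 1: "eventually (\<lambda>x. r < x \<and> x < t \<and> x < r + \<epsilon> n) (at_right r)" for n
    using t \<epsilon>[of n] unfolding eventually_at_right_field by (intro exI[of _ "min t (r + \<epsilon> n)"]) auto
  have 2: "eventually (\<lambda>x. t < x \<and> x < v \<and> v - \<epsilon> n < x) (at_left v)" for n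
    using t \<epsilon>[of n] unfolding eventually_at_left_field by (intro exI[of _ "max t (v - \<epsilon> n)"]) auto
  have m1: "eventually (\<lambda>x. X x \<in> borel_measurable Q) (at_right r)"
    using 1[of 0] by eventually_elim (use t in \<open>auto intro!: measurable_X\<close>)
  have m2: "eventually (\<lambda>x. X x \<in> borel_measurable Q) (at_left v)"
    using 2[of 0] by eventually_elim (use t in \<open>auto intro!: measurable_X\<close>)
  have tp: "tendsto_in_prob Q X z\<^sub>r (at_right r)" "tendsto_in_prob Q X z\<^sub>v (at_left v)"
    using bridge by (auto simp: bridge_def)
  obtain s :: "nat \<Rightarrow> real" where s: "\<And>n. r < s n \<and> s n < t \<and> s n < r + \<epsilon> n" "AE \<omega> in Q. (\<lambda>n. X (s n) \<omega>) \<longlonglongrightarrow> z\<^sub>r"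
    using tendsto_in_prob_imp_AE_seq[OF prob_space_Q tp(1) trivial_limit_at_right_real m1,
        where R = "\<lambda>n x. r < x \<and> x < t \<and> x < r + \<epsilon> n"] 1 by blast
  obtain u :: "nat \<Rightarrow> real" where u: "\<And>n. t < u n \<and> u n < v \<and> v - \<epsilon> n < u n" "AE \<omega> in Q. (\<lambda>n. X (u n) \<omega>) \<longlonglongrightarrow> z\<^sub>v"
    using tendsto_in_prob_imp_AE_seq[OF prob_space_Q tp(2) trivial_limit_at_left_real m2,
        where R = "\<lambda>n x. t < x \<and> x < v \<and> v - \<epsilon> n < x"] 2 by blast
  have "(\<lambda>n. r + \<epsilon> n) \<longlonglongrightarrow> r" using tendsto_add[OF tendsto_const \<epsilon>0, of r] by simp
  then have "s \<longlonglongrightarrow> r"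
    by (rule tendsto_sandwich[OF _ _ tendsto_const, rotated 2]) (use s(1) in \<open>auto intro!: always_eventually less_imp_le\<close>)
  have "(\<lambda>n. v - \<epsilon> n) \<longlonglongrightarrow> v" using tendsto_diff[OF tendsto_const \<epsilon>0, of v] by simp
  then have "u \<longlonglongrightarrow> v"
    by (rule tendsto_sandwich[OF _ _ _ tendsto_const, rotated 2]) (use u(1) in \<open>auto intro!: always_eventually less_imp_le\<close>)
  show ?thesis
    by (rule that[of s u]) (use s u \<open>s \<longlonglongrightarrow> r\<close> \<open>u \<longlonglongrightarrow> v\<close> in auto)
qed

lemma tendsto_K_at:
  assumes "s \<longlonglongrightarrow> r" "u \<longlonglongrightarrow> v" "x \<longlonglongrightarrow> z\<^sub>r" "y \<longlonglongrightarrow> z\<^sub>v"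
  shows "(\<lambda>n. K_at (s n) (u n) (x n) (y n)) \<longlonglongrightarrow> K_at r v z\<^sub>r z\<^sub>v"
  unfolding qh_K_def using r_less_v by (intro tendsto_intros assms) auto

lemma tendsto_den: "s \<longlonglongrightarrow> r \<Longrightarrow> u \<longlonglongrightarrow> v \<Longrightarrow> (\<lambda>n. den (s n) (u n)) \<longlonglongrightarrow> den r v"
  unfolding den_def by (intro tendsto_intros)

text \<open>Near the end points \<open>K_at\<close> is close to its positive limit, so
  \<open>C\<close> must be nonnegative there, and \<open>C_mult_den\<close> makes \<open>den\<close>
  positive along the sequences. The limit is thus at least 0, and it is not 0 because
  \<open>C_mult_den\<close> also holds at \<open>r\<close>, \<open>v\<close> themselves, as these
  are times of \<open>Z\<close>.\<close>

lemma den_pos: "den r v > 0"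
proof -
  define t where "t = (r + v) / 2"
  have t: "r < t" "t < v" using r_less_v by (auto simp: t_def)
  obtain s u :: "nat \<Rightarrow> real" where su: "\<And>n. r < s n" "\<And>n. s n < t" "s \<longlonglongrightarrow> r"
    "\<And>n. t < u n" "\<And>n. u n < v" "u \<longlonglongrightarrow> v"
    and X: "AE \<omega> in Q. (\<lambda>n. X (s n) \<omega>) \<longlonglongrightarrow> z\<^sub>r" "AE \<omega> in Q. (\<lambda>n. X (u n) \<omega>) \<longlonglongrightarrow> z\<^sub>v"
    by (rule endpoint_sequences[OF t]) blast
  interpret Q: prob_space Q by (rule prob_space_Q)
  have "AE \<omega> in Q. \<forall>n. 0 \<le> C t (s n) (u n) * K_at (s n) (u n) (X (s n) \<omega>) (X (u n) \<omega>)"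
    unfolding AE_all_countable using su by (auto intro!: C_K_at_X_nonneg)
  with X have "AE \<omega> in Q. eventually (\<lambda>n. 0 \<le> C t (s n) (u n)) sequentially"
  proof eventually_elim
    case (elim \<omega>)
    note nonneg = elim(3)[rule_format]
    have "eventually (\<lambda>n. 0 < K_at (s n) (u n) (X (s n) \<omega>) (X (u n) \<omega>)) sequentially"
      using tendsto_K_at[OF su(3,6) elim(1,2)] K_pos by (rule order_tendstoD)
    then show ?case
    proof eventually_elim
      case (elim n)
      then show ?case using nonneg[of n] by (simp add: zero_le_mult_iff)
    qed
  qed
  \<comment> \<open>The statement does not involve the sample point, so holding almost surely means
    holding.\<close>
  then have "eventually (\<lambda>n. 0 \<le> C t (s n) (u n)) sequentially" by simp
  then have "eventually (\<lambda>n. 0 \<le> den (s n) (u n)) sequentially"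
  proof eventually_elim
    case (elim n)
    have "0 < C t (s n) (u n) * den (s n) (u n)"
      using su(1,2,4,5)[of n] t by (subst C_mult_den) (auto intro!: in_T intro: less_trans)
    then show ?case using elim by (auto simp: zero_less_mult_iff)
  qed
  then have "0 \<le> den r v"
    by (intro tendsto_lowerbound[OF tendsto_den[OF su(3,6)]]) auto
  moreover have "den r v \<noteq> 0" by (rule den_neq_0[OF r_T in_T[OF t] v_T t])
  ultimately show ?thesis by simp
qed

lemma tendsto_C:
  assumes t: "r < t" "t < v"
    and su: "\<And>n. r < s n" "\<And>n. s n < t" "s \<longlonglongrightarrow> r" "\<And>n. t < u n" "\<And>n. u n < v" "u \<longlonglongrightarrow> v"
  shows "(\<lambda>n. C t (s n) (u n)) \<longlonglongrightarrow> (t - r) * (v - t) / den r v"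
proof -
  have rv: "s n < v" "r < u n" for n using su(2,4)[of n] t by auto
  have "C t (s n) (u n) = (t - s n) * (u n - t) / den (s n) (u n)" for n
    using su rv t by (intro C_eq) (auto intro!: in_T)
  then show ?thesis
    using den_pos by (auto intro!: tendsto_intros su(3,6) tendsto_den)
qed

text \<open>No moment of the bridge is assumed; integrability comes out of this Fatou argument.\<close>

lemma square_integrable_bound:
  assumes t: "r < t" "t < v"
  shows "integrable Q (\<lambda>\<omega>. (X t \<omega> - line t)\<^sup>2)" "(\<integral>\<omega>. (X t \<omega> - line t)\<^sup>2 \<partial>Q) \<le> bridge_var t"
proof -
  obtain s u :: "nat \<Rightarrow> real" where su: "\<And>n. r < s n" "\<And>n. s n < t" "s \<longlonglongrightarrow> r"
    "\<And>n. t < u n" "\<And>n. u n < v" "u \<longlonglongrightarrow> v"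
    and X: "AE \<omega> in Q. (\<lambda>n. X (s n) \<omega>) \<longlonglongrightarrow> z\<^sub>r" "AE \<omega> in Q. (\<lambda>n. X (u n) \<omega>) \<longlonglongrightarrow> z\<^sub>v"
    by (rule endpoint_sequences[OF t]) blast
  have rv: "s n < v" "r < u n" for n using su(2,4)[of n] t by auto
  have V: "0 \<le> bridge_var t" unfolding bridge_var_def using den_pos K_pos t by simp
  note measurable_X[OF t, measurable]
  define h where "h n \<omega> = (interp (s n) t (u n) (X (s n) \<omega>) (X (u n) \<omega>) - line t)\<^sup>2
    + C t (s n) (u n) * K_at (s n) (u n) (X (s n) \<omega>) (X (u n) \<omega>)" for n \<omega>
  have C: "(\<lambda>n. C t (s n) (u n)) \<longlonglongrightarrow> (t - r) * (v - t) / den r v"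
    by (rule tendsto_C[OF t su])
  have le: "(\<integral>\<^sup>+\<omega>. ennreal ((X t \<omega> - line t)\<^sup>2) \<partial>Q) \<le> ennreal (bridge_var t)"
  proof (rule nn_integral_le_of_cond_exp_limit[OF prob_space_Q, where h = h
        and G = "\<lambda>n. process_sigma Q X {s n, u n}"])
    show "subalgebra Q (process_sigma Q X {s n, u n})" for n
      by (rule subalgebra_process_sigma) (use su rv in \<open>auto intro!: measurable_X\<close>)
    show "h n \<in> borel_measurable (process_sigma Q X {s n, u n})" for n
    proof -
      have [measurable]: "X (s n) \<in> borel_measurable (process_sigma Q X {s n, u n})"
        "X (u n) \<in> borel_measurable (process_sigma Q X {s n, u n})"
        by (auto intro: measurable_process_sigma)
      show ?thesis unfolding h_def interp_def qh_K_def by measurable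
    qed
    show "ext_cond_exp_is Q (process_sigma Q X {s n, u n}) (\<lambda>\<omega>. (X t \<omega> - line t)\<^sup>2) (h n)" for n
      unfolding h_def by (rule cond_exp_X_finite) (use su rv in auto)
    show "AE \<omega> in Q. (\<lambda>n. h n \<omega>) \<longlonglongrightarrow> bridge_var t"
      using X
    proof eventually_elim
      case (elim \<omega>)
      have "(\<lambda>n. interp (s n) t (u n) (X (s n) \<omega>) (X (u n) \<omega>)) \<longlonglongrightarrow> line t"
        unfolding interp_def line_def using r_less_v by (intro tendsto_intros su(3,6) elim) auto
      \<comment> \<open>Taking \<open>a = line t\<close> makes the squared bias vanish in the limit,
        so only the variance term remains.\<close>
      then have "(\<lambda>n. h n \<omega>) \<longlonglongrightarrow> (line t - line t)\<^sup>2 + (t - r) * (v - t) / den r v * K_at r v z\<^sub>r z\<^sub>v"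
        unfolding h_def by (intro tendsto_intros tendsto_K_at C su(3,6) elim)
      then show ?case by (simp add: bridge_var_def)
    qed
  qed (use V in auto)
  show int: "integrable Q (\<lambda>\<omega>. (X t \<omega> - line t)\<^sup>2)"
    by (rule integrableI_bounded) (use le in \<open>auto intro: le_less_trans\<close>)
  show "(\<integral>\<omega>. (X t \<omega> - line t)\<^sup>2 \<partial>Q) \<le> bridge_var t"
    using le V nn_integral_eq_integral[OF int] by (simp add: ennreal_le_iff)
qed

end

section \<open>Mean and covariance of the deviation from the chord\<close>

context quadratic_harness_bridge
begin

definition W :: "real \<Rightarrow> 'b \<Rightarrow> real" where "W t \<omega> = X t \<omega> - line t"

text \<open>\<open>slope\<close> and \<open>icpt\<close> are the coefficients of the chord and at
  the same time the \<open>\<Delta>\<close> and \<open>\<Delta>'\<close> of the theorem.\<close>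

definition slope :: real where "slope = (z\<^sub>v - z\<^sub>r) / (v - r)"

definition icpt :: real where "icpt = (v * z\<^sub>r - r * z\<^sub>v) / (v - r)"

abbreviation q :: "real \<Rightarrow> real \<Rightarrow> real" where "q s t \<equiv> (\<integral>\<omega>. W s \<omega> * W t \<omega> \<partial>Q)"

lemma line_eq: "line t = icpt + slope * t"
  using r_less_v unfolding line_def interp_def icpt_def slope_def
  by (simp add: field_simps)

lemma interp_line: "s < u \<Longrightarrow> interp s t u (line s) (line u) = line t"
proof -
  assume "s < u"
  have "interp s t u (line s) (line u) = ((u - t) * line s + (t - s) * line u) / (u - s)"
    by (simp add: interp_def add_divide_distrib)
  also have "(u - t) * line s + (t - s) * line u = line t * (u - s)"
    unfolding line_eq by (simp add: algebra_simps)
  finally show ?thesis using \<open>s < u\<close> by simp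
qed

lemma interp_X:
  "s < u \<Longrightarrow> interp s t u (X s \<omega>) (X u \<omega>) = interp s t u (W s \<omega>) (W u \<omega>) + line t"
  using interp_line[of s u t] by (simp add: W_def interp_def algebra_simps)

text \<open>Both arguments of \<open>K_at\<close> are linear in the pair of values, being slope and
  intercept of the line through two points. The chord therefore contributes the same constants for
  all \<open>s\<close> and \<open>u\<close>.\<close>

lemma K_at_X:
  assumes "s < u"
  shows "K_at s u (X s \<omega>) (X u \<omega>) =
    qh_K \<eta> \<theta> \<sigma> \<tau> \<gamma> ((W u \<omega> - W s \<omega>) / (u - s) + slope) ((u * W s \<omega> - s * W u \<omega>) / (u - s) + icpt)"
proof -
  have "(X u \<omega> - X s \<omega>) / (u - s) = (W u \<omega> - W s \<omega>) / (u - s) + slope"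
    using assms unfolding W_def line_eq by (simp add: field_simps)
  moreover have "(u * X s \<omega> - s * X u \<omega>) / (u - s) = (u * W s \<omega> - s * W u \<omega>) / (u - s) + icpt"
    using assms unfolding W_def line_eq by (simp add: field_simps)
  ultimately show ?thesis by simp
qed

lemma measurable_W: "r < t \<Longrightarrow> t < v \<Longrightarrow> W t \<in> borel_measurable Q"
  unfolding W_def[abs_def] using measurable_X by simp

lemma square_integrable_W: "r < t \<Longrightarrow> t < v \<Longrightarrow> integrable Q (\<lambda>\<omega>. (W t \<omega>)\<^sup>2)"
  unfolding W_def by (rule square_integrable_bound)

lemma integrable_W: "r < t \<Longrightarrow> t < v \<Longrightarrow> integrable Q (W t)"
proof -
  assume t: "r < t" "t < v"
  interpret prob_space Q by (rule prob_space_Q)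
  show ?thesis by (rule square_integrable_imp_integrable[OF measurable_W[OF t] square_integrable_W[OF t]])
qed

lemma integrable_W_mult:
  "r < s \<Longrightarrow> s < v \<Longrightarrow> r < t \<Longrightarrow> t < v \<Longrightarrow> integrable Q (\<lambda>\<omega>. W s \<omega> * W t \<omega>)"
  by (intro integrable_mult_of_squares measurable_W square_integrable_W)

lemma integral_W_sq_le: "r < t \<Longrightarrow> t < v \<Longrightarrow> q t t \<le> bridge_var t"
  using square_integrable_bound(2)[of t] by (simp add: W_def power2_eq_square)

lemma integrable_X: "r < t \<Longrightarrow> t < v \<Longrightarrow> integrable Q (X t)"
proof -
  assume t: "r < t" "t < v"
  interpret prob_space Q by (rule prob_space_Q)
  have "integrable Q (\<lambda>\<omega>. W t \<omega> + line t)" using integrable_W[OF t] by simp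
  then show ?thesis by (simp add: W_def)
qed

lemma integral_X: "r < t \<Longrightarrow> t < v \<Longrightarrow> (\<integral>\<omega>. X t \<omega> \<partial>Q) = (\<integral>\<omega>. W t \<omega> \<partial>Q) + line t"
proof -
  assume t: "r < t" "t < v"
  interpret prob_space Q by (rule prob_space_Q)
  have "(\<integral>\<omega>. W t \<omega> + line t \<partial>Q) = (\<integral>\<omega>. W t \<omega> \<partial>Q) + line t"
    using integrable_W[OF t] by (simp add: prob_space)
  then show ?thesis by (simp add: W_def)
qed

lemmas integral_W_affine_mult = integral_affine_mult[OF prob_space_Q measurable_W measurable_W
    square_integrable_W square_integrable_W]

lemma integrable_X_shift_sq: "r < t \<Longrightarrow> t < v \<Longrightarrow> integrable Q (\<lambda>\<omega>. (X t \<omega> - a)\<^sup>2)"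
  using integral_W_affine_mult(1)[of t t 1 0 "line t - a" 1 0 "line t - a"]
  by (simp add: W_def power2_eq_square)

context
  fixes s t u :: real
  assumes stu: "r < s" "s < t" "t < u" "u < v"
begin

lemma integrable_interp_X_shift_sq: "integrable Q (\<lambda>\<omega>. (interp s t u (X s \<omega>) (X u \<omega>) - a)\<^sup>2)"
  using stu integral_W_affine_mult(1)[of s u "(u - t) / (u - s)" "(t - s) / (u - s)" "line t - a"
    "(u - t) / (u - s)" "(t - s) / (u - s)" "line t - a"]
  by (simp add: interp_X) (simp add: interp_def power2_eq_square algebra_simps)

lemma integrable_interp_X: "integrable Q (\<lambda>\<omega>. interp s t u (X s \<omega>) (X u \<omega>))"
  unfolding interp_def using stu integrable_X by simp

lemma K_at_X_expand:
  fixes w :: real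
  defines "w \<equiv> 1 / (u - s)"
  shows "K_at s u (X s \<omega>) (X u \<omega>) =
     1 + \<eta> * ((0 * W s \<omega> + 0 * W u \<omega> + 1) * ((w * u) * W s \<omega> + (- w * s) * W u \<omega> + icpt))
     + \<theta> * ((0 * W s \<omega> + 0 * W u \<omega> + 1) * ((- w) * W s \<omega> + w * W u \<omega> + slope))
     + \<sigma> * (((w * u) * W s \<omega> + (- w * s) * W u \<omega> + icpt) * ((w * u) * W s \<omega> + (- w * s) * W u \<omega> + icpt))
     + \<tau> * (((- w) * W s \<omega> + w * W u \<omega> + slope) * ((- w) * W s \<omega> + w * W u \<omega> + slope))
     - (1 - \<gamma>) * (((- w) * W s \<omega> + w * W u \<omega> + slope) * ((w * u) * W s \<omega> + (- w * s) * W u \<omega> + icpt))"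
proof -
  have w: "x / (u - s) = w * x" for x by (simp add: w_def)
  have "s < u" using stu by simp
  have 1: "(W u \<omega> - W s \<omega>) / (u - s) + slope = (- w) * W s \<omega> + w * W u \<omega> + slope"
    unfolding w by (simp add: algebra_simps)
  have 2: "(u * W s \<omega> - s * W u \<omega>) / (u - s) + icpt = (w * u) * W s \<omega> + (- w * s) * W u \<omega> + icpt"
    unfolding w by (simp add: algebra_simps)
  show ?thesis
    unfolding K_at_X[OF \<open>s < u\<close>] unfolding 1 2 qh_K_def power2_eq_square by simp
qed

lemma integrable_K_at_X: "integrable Q (\<lambda>\<omega>. K_at s u (X s \<omega>) (X u \<omega>))"
proof -
  interpret prob_space Q by (rule prob_space_Q)
  show ?thesis
    unfolding K_at_X_expand using stu
    by (intro Bochner_Integration.integrable_add Bochner_Integration.integrable_diff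
        integrable_mult_right integral_W_affine_mult(1)) auto
qed

lemma cond_exp_X_process_sigma:
  assumes I: "finite I" "{s, u} \<subseteq> I" "I \<subseteq> {x \<in> {r<..<v}. x \<le> s \<or> u \<le> x}"
  shows "AE \<omega> in Q. real_cond_exp Q (process_sigma Q X I) (X t) \<omega> = interp s t u (X s \<omega>) (X u \<omega>)"
    and "AE \<omega> in Q. real_cond_exp Q (process_sigma Q X I) (\<lambda>\<omega>. (X t \<omega> - a)\<^sup>2) \<omega> =
      (interp s t u (X s \<omega>) (X u \<omega>) - a)\<^sup>2 + C t s u * K_at s u (X s \<omega>) (X u \<omega>)"
proof -
  have I': "I \<subseteq> {r<..<v}" "s \<in> I" "u \<in> I" "\<And>i. i \<in> I \<Longrightarrow> i \<le> s \<or> u \<le> i"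
    using I by auto
  show "AE \<omega> in Q. real_cond_exp Q (process_sigma Q X I) (X t) \<omega> = interp s t u (X s \<omega>) (X u \<omega>)"
    using cond_exp_X_finite(1)[OF I(1) I' stu(2,3)] by (simp add: ext_cond_exp_is_def)
  show "AE \<omega> in Q. real_cond_exp Q (process_sigma Q X I) (\<lambda>\<omega>. (X t \<omega> - a)\<^sup>2) \<omega> =
      (interp s t u (X s \<omega>) (X u \<omega>) - a)\<^sup>2 + C t s u * K_at s u (X s \<omega>) (X u \<omega>)"
    using cond_exp_X_finite(2)[OF I(1) I' stu(2,3), of a] by (simp add: ext_cond_exp_is_def)
qed

lemma measurable_X_nat:
  "X s \<in> borel_measurable (natural_filtration Q {r<..<v} X s u)"
  "X u \<in> borel_measurable (natural_filtration Q {r<..<v} X s u)"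
  unfolding natural_filtration_def using stu by (auto intro!: measurable_process_sigma)

text \<open>The formula is the same for all finite conditioning sets that contain \<open>s\<close>
  and \<open>u\<close>; the Dynkin argument applies with \<open>{s, u}\<close> as base set now that
  both sides are integrable.\<close>

lemma cond_exp_X_nat:
  "AE \<omega> in Q. real_cond_exp Q (natural_filtration Q {r<..<v} X s u) (X t) \<omega> =
    interp s t u (X s \<omega>) (X u \<omega>)"
  "AE \<omega> in Q. real_cond_exp Q (natural_filtration Q {r<..<v} X s u) (\<lambda>\<omega>. (X t \<omega> - a)\<^sup>2) \<omega> =
      (interp s t u (X s \<omega>) (X u \<omega>) - a)\<^sup>2 + C t s u * K_at s u (X s \<omega>) (X u \<omega>)"
proof -
  note [measurable] = measurable_X_nat[unfolded natural_filtration_def]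
  have su: "{s, u} \<subseteq> {x \<in> {r<..<v}. x \<le> s \<or> u \<le> x}" using stu by auto
  show "AE \<omega> in Q. real_cond_exp Q (natural_filtration Q {r<..<v} X s u) (X t) \<omega> =
    interp s t u (X s \<omega>) (X u \<omega>)"
    unfolding natural_filtration_def
  proof (rule real_cond_exp_process_sigmaI[OF prob_space_Q _ _ integrable_interp_X _ _ su])
    show "(\<lambda>\<omega>. interp s t u (X s \<omega>) (X u \<omega>)) \<in>
      borel_measurable (process_sigma Q X {ra \<in> {r<..<v}. ra \<le> s \<or> u \<le> ra})"
      unfolding interp_def by measurable
    show "AE \<omega> in Q. real_cond_exp Q (process_sigma Q X I) (X t) \<omega> = interp s t u (X s \<omega>) (X u \<omega>)"
      if "finite I" "{s, u} \<subseteq> I" "I \<subseteq> {x \<in> {r<..<v}. x \<le> s \<or> u \<le> x}" for I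
      using that by (rule cond_exp_X_process_sigma)
  qed (use stu in \<open>auto intro: measurable_X integrable_X\<close>)
  show "AE \<omega> in Q. real_cond_exp Q (natural_filtration Q {r<..<v} X s u) (\<lambda>\<omega>. (X t \<omega> - a)\<^sup>2) \<omega> =
      (interp s t u (X s \<omega>) (X u \<omega>) - a)\<^sup>2 + C t s u * K_at s u (X s \<omega>) (X u \<omega>)"
    unfolding natural_filtration_def
  proof (rule real_cond_exp_process_sigmaI[OF prob_space_Q _ _ _ _ _ su])
    show "integrable Q (\<lambda>\<omega>. (interp s t u (X s \<omega>) (X u \<omega>) - a)\<^sup>2 + C t s u * K_at s u (X s \<omega>) (X u \<omega>))"
      using integrable_interp_X_shift_sq integrable_K_at_X by simp
    show "(\<lambda>\<omega>. (interp s t u (X s \<omega>) (X u \<omega>) - a)\<^sup>2 + C t s u * K_at s u (X s \<omega>) (X u \<omega>)) \<in>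
      borel_measurable (process_sigma Q X {ra \<in> {r<..<v}. ra \<le> s \<or> u \<le> ra})"
      unfolding interp_def qh_K_def by measurable
    show "AE \<omega> in Q. real_cond_exp Q (process_sigma Q X I) (\<lambda>\<omega>. (X t \<omega> - a)\<^sup>2) \<omega> =
        (interp s t u (X s \<omega>) (X u \<omega>) - a)\<^sup>2 + C t s u * K_at s u (X s \<omega>) (X u \<omega>)"
      if "finite I" "{s, u} \<subseteq> I" "I \<subseteq> {x \<in> {r<..<v}. x \<le> s \<or> u \<le> x}" for I
      using that by (rule cond_exp_X_process_sigma)
  qed (use stu in \<open>auto intro: measurable_X integrable_X_shift_sq\<close>)
qed

lemma mean_W_interp:
  "(\<integral>\<omega>. W t \<omega> \<partial>Q) = interp s t u (\<integral>\<omega>. W s \<omega> \<partial>Q) (\<integral>\<omega>. W u \<omega> \<partial>Q)"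
proof -
  have rv: "r < t" "t < v" "s < v" "r < u" using stu by auto
  interpret sigma_finite_subalgebra Q "process_sigma Q X {s, u}"
    by (rule sigma_finite_X) (use stu in auto)
  have "(\<integral>\<omega>. X t \<omega> \<partial>Q) = (\<integral>\<omega>. real_cond_exp Q (process_sigma Q X {s, u}) (X t) \<omega> \<partial>Q)"
    using real_cond_exp_int(2)[OF integrable_X[OF rv(1,2)]] by simp
  also have "\<dots> = (\<integral>\<omega>. interp s t u (X s \<omega>) (X u \<omega>) \<partial>Q)"
    using integrable_interp_X stu
    by (intro integral_cong_AE cond_exp_X_process_sigma) (auto intro: borel_measurable_integrable)
  also have "\<dots> = interp s t u (\<integral>\<omega>. X s \<omega> \<partial>Q) (\<integral>\<omega>. X u \<omega> \<partial>Q)"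
    unfolding interp_def using stu rv integrable_X by simp
  finally show ?thesis
    using stu rv interp_line[of s u t] by (simp add: integral_X interp_def algebra_simps)
qed

end

lemma bridge_var_nonneg: "r < t \<Longrightarrow> t < v \<Longrightarrow> 0 \<le> bridge_var t"
  unfolding bridge_var_def using den_pos K_pos by simp

lemma tendsto_bridge_var:
  assumes "s \<longlonglongrightarrow> r \<or> s \<longlonglongrightarrow> v"
  shows "(\<lambda>n. bridge_var (s n)) \<longlonglongrightarrow> 0"
proof -
  obtain l where l: "s \<longlonglongrightarrow> l" "l = r \<or> l = v" using assms by auto
  have "(\<lambda>n. bridge_var (s n)) \<longlonglongrightarrow> bridge_var l"
    unfolding bridge_var_def using den_pos by (intro tendsto_intros l) auto
  then show ?thesis using l(2) by (auto simp: bridge_var_def)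
qed

lemma integral_W_mult_sq_le:
  assumes "r < s" "s < v" "r < t" "t < v"
  shows "\<bar>q s t\<bar> \<le> sqrt (bridge_var s * bridge_var t)"
proof -
  have "(q s t)\<^sup>2 \<le> q s s * q t t"
    using integral_mult_power2_le[OF measurable_W measurable_W square_integrable_W square_integrable_W,
      OF assms assms] by (simp add: power2_eq_square)
  also have "\<dots> \<le> bridge_var s * bridge_var t"
    using assms bridge_var_nonneg by (intro mult_mono integral_W_sq_le) auto
  finally show ?thesis by (simp add: real_le_rsqrt)
qed

text \<open>The mean at \<open>t\<close> interpolates the means at \<open>s\<close> and
  \<open>u\<close>, which tend to 0 at the end points because they are bounded by the square root of
  \<open>bridge_var\<close>.\<close>

lemma mean_W:
  assumes t: "r < t" "t < v"
  shows "(\<integral>\<omega>. W t \<omega> \<partial>Q) = 0"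
proof -
  interpret prob_space Q by (rule prob_space_Q)
  have bound: "\<bar>\<integral>\<omega>. W x \<omega> \<partial>Q\<bar> \<le> sqrt (bridge_var x)" if "r < x" "x < v" for x
  proof -
    have "(\<integral>\<omega>. W x \<omega> \<partial>Q)\<^sup>2 \<le> q x x"
      using integral_mult_power2_le[OF measurable_W _ square_integrable_W, OF that _ that, of "\<lambda>_. 1"]
      by (simp add: power2_eq_square prob_space)
    also have "\<dots> \<le> bridge_var x" using that by (rule integral_W_sq_le)
    finally show ?thesis by (simp add: real_le_rsqrt)
  qed
  have lim: "(\<lambda>n. \<integral>\<omega>. W (x n) \<omega> \<partial>Q) \<longlonglongrightarrow> 0"
    if "\<And>n. r < x n" "\<And>n. x n < v" "x \<longlonglongrightarrow> r \<or> x \<longlonglongrightarrow> v" for x :: "nat \<Rightarrow> real"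
  proof (rule Lim_null_comparison)
    show "(\<lambda>n. sqrt (bridge_var (x n))) \<longlonglongrightarrow> 0"
      using tendsto_real_sqrt[OF tendsto_bridge_var[OF that(3)]] by simp
  qed (use bound that in auto)
  obtain s u :: "nat \<Rightarrow> real" where su: "\<And>n. r < s n" "\<And>n. s n < t" "s \<longlonglongrightarrow> r"
    "\<And>n. t < u n" "\<And>n. u n < v" "u \<longlonglongrightarrow> v"
    by (rule endpoint_sequences[OF t]) blast
  have rv: "s n < v" "r < u n" for n using su(2,4)[of n] t by auto
  have "(\<lambda>n. interp (s n) t (u n) (\<integral>\<omega>. W (s n) \<omega> \<partial>Q) (\<integral>\<omega>. W (u n) \<omega> \<partial>Q)) \<longlonglongrightarrow> interp r t v 0 0"
    unfolding interp_def using r_less_v su rv by (intro tendsto_intros lim) auto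
  then have "(\<lambda>n. \<integral>\<omega>. W t \<omega> \<partial>Q) \<longlonglongrightarrow> 0"
    using mean_W_interp[OF su(1,2,4,5)] by (simp add: interp_def)
  then show ?thesis by (simp add: LIMSEQ_const_iff)
qed

text \<open>By Cauchy-Schwarz it is enough that one time approaches an end point; the other may
  converge anywhere in between, or stay fixed.\<close>

lemma tendsto_q:
  assumes x: "\<And>n. r < x n" "\<And>n. x n < v" "x \<longlonglongrightarrow> r \<or> x \<longlonglongrightarrow> v"
    and y: "\<And>n. r < y n" "\<And>n. y n < v" "y \<longlonglongrightarrow> l" "r \<le> l" "l \<le> v"
  shows "(\<lambda>n. q (y n) (x n)) \<longlonglongrightarrow> 0"
proof (rule Lim_null_comparison)
  have "(\<lambda>n. bridge_var (y n)) \<longlonglongrightarrow> bridge_var l"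
    unfolding bridge_var_def using den_pos by (intro tendsto_intros y) auto
  from tendsto_mult[OF this tendsto_bridge_var[OF x(3)]]
  show "(\<lambda>n. sqrt (bridge_var (y n) * bridge_var (x n))) \<longlonglongrightarrow> 0"
    using tendsto_real_sqrt by fastforce
  show "\<forall>\<^sub>F n in sequentially. norm (q (y n) (x n)) \<le> sqrt (bridge_var (y n) * bridge_var (x n))"
    using integral_W_mult_sq_le x y by simp
qed

text \<open>\<open>W s\<close> is measurable with respect to the conditioning field, so it can be
  multiplied into the harness identity before expectations are taken.\<close>

lemma q_interp:
  assumes stu: "r < s" "s < t" "t < u" "u < v"
  shows "q s t = interp s t u (q s s) (q s u)"
proof -
  let ?G = "process_sigma Q X {s, u}"
  have rv: "r < t" "t < v" "s < v" "r < u" "s < u" using stu by auto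
  interpret sigma_finite_subalgebra Q ?G by (rule sigma_finite_X) (use stu in auto)
  have Ws: "W s \<in> borel_measurable ?G"
    unfolding W_def[abs_def] using measurable_process_sigma[of s "{s, u}" X Q] by simp
  note [measurable] = measurable_X[OF rv(1,2)] measurable_W[OF stu(1) rv(3)] measurable_W[OF rv(4) stu(4)]
  have X: "X t \<omega> = W t \<omega> + line t" for \<omega> by (simp add: W_def)
  have Wi: "integrable Q (\<lambda>\<omega>. W s \<omega> * line t)" "integrable Q (\<lambda>\<omega>. W s \<omega> * W t \<omega>)"
    using stu rv integrable_W integrable_W_mult by auto
  have WX: "integrable Q (\<lambda>\<omega>. W s \<omega> * X t \<omega>)"
    unfolding X distrib_left using Wi by simp
  have "q s t = (\<integral>\<omega>. W s \<omega> * X t \<omega> \<partial>Q)"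
    unfolding X distrib_left using Wi stu rv by (simp add: mean_W)
  also have "\<dots> = (\<integral>\<omega>. W s \<omega> * real_cond_exp Q ?G (X t) \<omega> \<partial>Q)"
    using WX Ws by (intro real_cond_exp_intg(2)[symmetric]) auto
  also have "\<dots> = (\<integral>\<omega>. W s \<omega> * (interp s t u (W s \<omega>) (W u \<omega>) + line t) \<partial>Q)"
  proof (rule integral_cong_AE)
    show "AE \<omega> in Q. W s \<omega> * real_cond_exp Q ?G (X t) \<omega> =
        W s \<omega> * (interp s t u (W s \<omega>) (W u \<omega>) + line t)"
      using cond_exp_X_process_sigma(1)[OF stu, of "{s, u}"] stu
      by (auto simp: interp_X[OF rv(5)])
  qed (simp_all add: interp_def)
  also have "\<dots> = (\<integral>\<omega>. (u - t) / (u - s) * (W s \<omega> * W s \<omega>) + (t - s) / (u - s) * (W s \<omega> * W u \<omega>)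
      + W s \<omega> * line t \<partial>Q)"
    by (simp add: interp_def algebra_simps)
  also have "\<dots> = interp s t u (q s s) (q s u)"
    using Wi stu rv by (simp add: mean_W integrable_W_mult interp_def)
  finally show ?thesis .
qed

text \<open>Letting \<open>u\<close> tend to \<open>v\<close> in \<open>q_interp\<close> removes
  \<open>q s u\<close>; hence the covariance decays linearly to 0 at \<open>v\<close>.\<close>

lemma q_eq_of_less:
  assumes st: "r < s" "s < t" "t < v"
  shows "q s t = (v - t) / (v - s) * q s s"
proof -
  have t: "r < t" "t < v" "s < v" using st by auto
  obtain s' u :: "nat \<Rightarrow> real" where u: "\<And>n. t < u n" "\<And>n. u n < v" "u \<longlonglongrightarrow> v"
    by (rule endpoint_sequences[OF t(1,2)]) blast
  have ru: "r < u n" for n using u(1)[of n] t by simp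
  have "(\<lambda>n. interp s t (u n) (q s s) (q s (u n))) \<longlonglongrightarrow> interp s t v (q s s) 0"
    unfolding interp_def using u st t ru
    by (intro tendsto_intros tendsto_q[where y = "\<lambda>_. s" and l = s]) auto
  then have "(\<lambda>n. q s t) \<longlonglongrightarrow> interp s t v (q s s) 0"
    using q_interp[OF st(1,2) u(1,2)] by simp
  then show ?thesis by (simp add: LIMSEQ_const_iff interp_def)
qed

text \<open>Left uncollected so that the limit can be read term by term: each \<open>q\<close> tends
  to 0, and what survives is \<open>K\<close> at the slope and intercept of the chord.\<close>

lemma integral_K_at_X:
  assumes stu: "r < s" "s < t" "t < u" "u < v"
  shows "(\<integral>\<omega>. K_at s u (X s \<omega>) (X u \<omega>) \<partial>Q) = 1 + \<eta> * icpt + \<theta> * slope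
     + \<sigma> * ((1 / (u - s) * u) * (1 / (u - s) * u) * q s s - 2 * (1 / (u - s) * u) * (1 / (u - s) * s) * q s u
       + (1 / (u - s) * s) * (1 / (u - s) * s) * q u u + icpt * icpt)
     + \<tau> * (1 / (u - s) * (1 / (u - s)) * q s s - 2 * (1 / (u - s)) * (1 / (u - s)) * q s u
       + 1 / (u - s) * (1 / (u - s)) * q u u + slope * slope)
     - (1 - \<gamma>) * (- (1 / (u - s)) * (1 / (u - s) * u) * q s s
       + ((1 / (u - s)) * (1 / (u - s) * s) + 1 / (u - s) * (1 / (u - s) * u)) * q s u
       - 1 / (u - s) * (1 / (u - s) * s) * q u u + slope * icpt)"
proof -
  interpret prob_space Q by (rule prob_space_Q)
  have rv: "s < v" "r < u" using stu by auto
  note W = integral_W_affine_mult[OF stu(1) rv stu(4) stu(1) rv stu(4)]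
  show ?thesis
    unfolding K_at_X_expand[OF stu]
    by (simp only: Bochner_Integration.integral_add Bochner_Integration.integral_diff
        Bochner_Integration.integrable_add Bochner_Integration.integrable_diff
        integral_mult_right_zero integrable_mult_right W
        integrable_const lebesgue_integral_const mean_W[OF stu(1) rv(1)] mean_W[OF rv(2) stu(4)])
      (simp add: prob_space)
qed

text \<open>Total variance again, this time about the chord: second moment of the interpolated
  deviation plus mean conditional variance.\<close>

lemma q_diag_eq:
  assumes stu: "r < s" "s < t" "t < u" "u < v"
  shows "q t t = ((u - t) / (u - s)) * ((u - t) / (u - s)) * q s s
    + 2 * ((u - t) / (u - s)) * ((t - s) / (u - s)) * q s u
    + ((t - s) / (u - s)) * ((t - s) / (u - s)) * q u u
    + C t s u * (\<integral>\<omega>. K_at s u (X s \<omega>) (X u \<omega>) \<partial>Q)"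
proof -
  let ?G = "process_sigma Q X {s, u}"
  have rv: "r < t" "t < v" "s < v" "r < u" "s < u" using stu by auto
  interpret sigma_finite_subalgebra Q ?G by (rule sigma_finite_X) (use stu in auto)
  have sq: "integrable Q (\<lambda>\<omega>. (X t \<omega> - line t)\<^sup>2)" by (rule integrable_X_shift_sq[OF rv(1,2)])
  note W = integral_W_affine_mult[OF stu(1) rv(3,4) stu(4) stu(1) rv(3,4) stu(4)]
  have "q t t = (\<integral>\<omega>. (X t \<omega> - line t)\<^sup>2 \<partial>Q)" by (simp add: W_def power2_eq_square)
  also have "\<dots> = (\<integral>\<omega>. real_cond_exp Q ?G (\<lambda>\<omega>. (X t \<omega> - line t)\<^sup>2) \<omega> \<partial>Q)"
    using real_cond_exp_int(2)[OF sq] by simp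
  also have "\<dots> = (\<integral>\<omega>. (interp s t u (X s \<omega>) (X u \<omega>) - line t)\<^sup>2 + C t s u * K_at s u (X s \<omega>) (X u \<omega>) \<partial>Q)"
    using cond_exp_X_process_sigma(2)[OF stu, of "{s, u}"] stu
      integrable_interp_X_shift_sq[OF stu] integrable_K_at_X[OF stu]
    by (intro integral_cong_AE) (auto intro!: borel_measurable_integrable)
  also have "\<dots> = (\<integral>\<omega>. (interp s t u (X s \<omega>) (X u \<omega>) - line t)\<^sup>2 \<partial>Q) + C t s u * (\<integral>\<omega>. K_at s u (X s \<omega>) (X u \<omega>) \<partial>Q)"
    using integrable_interp_X_shift_sq[OF stu] integrable_K_at_X[OF stu] by simp
  also have "(\<integral>\<omega>. (interp s t u (X s \<omega>) (X u \<omega>) - line t)\<^sup>2 \<partial>Q) =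
      ((u - t) / (u - s)) * ((u - t) / (u - s)) * q s s
    + 2 * ((u - t) / (u - s)) * ((t - s) / (u - s)) * q s u
    + ((t - s) / (u - s)) * ((t - s) / (u - s)) * q u u"
    using W(2)[of "(u - t) / (u - s)" "(t - s) / (u - s)" 0 "(u - t) / (u - s)" "(t - s) / (u - s)" 0] rv
    by (simp add: interp_X) (simp add: interp_def power2_eq_square)
  finally show ?thesis .
qed

text \<open>In the limit of \<open>q_diag_eq\<close> all covariances on the right vanish and
  \<open>C\<close> times the mean of \<open>K_at\<close> tends to \<open>bridge_var t\<close>, so
  the Fatou bound is attained.\<close>

lemma q_diag:
  assumes t: "r < t" "t < v"
  shows "q t t = bridge_var t"
proof -
  obtain s u :: "nat \<Rightarrow> real" where su: "\<And>n. r < s n" "\<And>n. s n < t" "s \<longlonglongrightarrow> r"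
    "\<And>n. t < u n" "\<And>n. u n < v" "u \<longlonglongrightarrow> v"
    by (rule endpoint_sequences[OF t]) blast
  have rv: "s n < v" "r < u n" for n using su(2,4)[of n] t by auto
  have C: "(\<lambda>n. C t (s n) (u n)) \<longlonglongrightarrow> (t - r) * (v - t) / den r v"
    by (rule tendsto_C[OF t su])
  have q0: "(\<lambda>n. q (s n) (s n)) \<longlonglongrightarrow> 0" "(\<lambda>n. q (s n) (u n)) \<longlonglongrightarrow> 0" "(\<lambda>n. q (u n) (u n)) \<longlonglongrightarrow> 0"
    using tendsto_q[of s s r] tendsto_q[of u s r] tendsto_q[of u u v] su rv r_less_v by simp_all
  have vr: "v - r \<noteq> 0" using r_less_v by simp
  have K: "(\<lambda>n. \<integral>\<omega>. K_at (s n) (u n) (X (s n) \<omega>) (X (u n) \<omega>) \<partial>Q) \<longlonglongrightarrow> K_at r v z\<^sub>r z\<^sub>v"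
    unfolding integral_K_at_X[OF su(1,2,4,5)] unfolding qh_K_def slope_def[symmetric] icpt_def[symmetric]
    by (rule tendsto_eq_intros q0 su(3,6) vr refl)+ (simp add: power2_eq_square)
  have "(\<lambda>n. ((u n - t) / (u n - s n)) * ((u n - t) / (u n - s n)) * q (s n) (s n)
    + 2 * ((u n - t) / (u n - s n)) * ((t - s n) / (u n - s n)) * q (s n) (u n)
    + ((t - s n) / (u n - s n)) * ((t - s n) / (u n - s n)) * q (u n) (u n)
    + C t (s n) (u n) * (\<integral>\<omega>. K_at (s n) (u n) (X (s n) \<omega>) (X (u n) \<omega>) \<partial>Q)) \<longlonglongrightarrow> bridge_var t"
    unfolding bridge_var_def by (rule tendsto_eq_intros q0 su(3,6) vr refl C K)+ simp
  then have "(\<lambda>n. q t t) \<longlonglongrightarrow> bridge_var t"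
    unfolding q_diag_eq[OF su(1,2,4,5), symmetric] .
  then show ?thesis by (simp add: LIMSEQ_const_iff)
qed

end

section \<open>The transformed process\<close>

lemma past_future_filtration_natural:
  assumes "stoch_process P T X"
  shows "past_future_filtration P T (natural_filtration P T X)"
  unfolding past_future_filtration_def natural_filtration_def
proof (intro conjI ballI impI)
  show "subalgebra P (process_sigma P X {r \<in> T. r \<le> s \<or> t \<le> r})" for s t
    using assms by (intro subalgebra_process_sigma) (auto simp: stoch_process_def)
qed (intro process_sigma_mono, auto)

lemma qh_K_scaled:
  "N * qh_K \<eta> \<theta> \<sigma> \<tau> \<gamma> x y = N + (N * \<eta>) * y + (N * \<theta>) * x + (N * \<sigma>) * y\<^sup>2 + (N * \<tau>) * x\<^sup>2
     - (N * (1 - \<gamma>)) * x * y"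
  by (simp add: qh_K_def algebra_simps)

text \<open>The origin of the five new parameters: \<open>K\<close> is expanded around
  \<open>(\<Delta>, \<Delta>')\<close> after an affine substitution, and its value
  \<open>M\<^sup>2 * D\<close> there is factored out so that the constant term becomes 1
  again.\<close>

lemma qh_K_affine:
  fixes M v r \<eta> \<theta> \<sigma> \<tau> \<gamma> \<Delta> \<Delta>' D :: real
  assumes v: "0 < v" and M: "M \<noteq> 0" and D: "D \<noteq> 0" "D = v * (1 + r * \<sigma>) + \<tau> - r * \<gamma>"
    and K: "qh_K \<eta> \<theta> \<sigma> \<tau> \<gamma> \<Delta> \<Delta>' = M\<^sup>2 * D"
  shows "qh_K \<eta> \<theta> \<sigma> \<tau> \<gamma> (M / sqrt v * (v * x - y) + \<Delta>) (M * sqrt v * (y - r * x) + \<Delta>') =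
    M\<^sup>2 * D * qh_K
         ((v * \<eta> - \<theta> - 2 * \<tau> * \<Delta> + 2 * \<sigma> * v * \<Delta>' - (1 - \<gamma>) * (v * \<Delta> - \<Delta>')) / (sqrt v * M * D))
         (sqrt v * (\<theta> - r * \<eta> + 2 * \<tau> * \<Delta> - 2 * r * \<sigma> * \<Delta>' - (1 - \<gamma>) * (\<Delta>' - r * \<Delta>)) / (M * D))
         ((\<sigma> * v\<^sup>2 + (1 - \<gamma>) * v + \<tau>) / (v * D))
         (v * ((\<sigma> * r\<^sup>2 + (1 - \<gamma>) * r + \<tau>) / D))
         ((v * \<gamma> - r * (v * \<sigma> + 1) - \<tau>) / D) x y"
    (is "?lhs = _ * qh_K ?\<eta> ?\<theta> ?\<sigma> ?\<tau> ?\<gamma> x y")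
proof -
  \<comment> \<open>With these abbreviations \<open>a v = b\<close> and no square roots remain.\<close>
  define a where "a = M / sqrt v"
  define b where "b = M * sqrt v"
  have w: "sqrt v > 0" "sqrt v * sqrt v = v" using v by auto
  have ab: "a * b = M\<^sup>2" and av: "a * v = b"
    using w by (simp_all add: a_def b_def power2_eq_square field_simps)
  have bb: "b * b = M\<^sup>2 * v" using ab av by (metis mult.assoc mult.commute)
  have aa: "a * a = M\<^sup>2 / v" using w by (simp add: a_def power2_eq_square)
  have 1: "M\<^sup>2 * D * ?\<eta> = a * (v * \<eta> - \<theta> - 2 * \<tau> * \<Delta> + 2 * \<sigma> * v * \<Delta>' - (1 - \<gamma>) * (v * \<Delta> - \<Delta>'))"
    using M D(1) w by (simp add: a_def power2_eq_square)
  have 2: "M\<^sup>2 * D * ?\<theta> = b * (\<theta> - r * \<eta> + 2 * \<tau> * \<Delta> - 2 * r * \<sigma> * \<Delta>' - (1 - \<gamma>) * (\<Delta>' - r * \<Delta>))"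
    using M D(1) by (simp add: b_def power2_eq_square)
  have 3: "M\<^sup>2 * D * ?\<sigma> = \<sigma> * (b * b) + (1 - \<gamma>) * (a * b) + \<tau> * (a * a)"
    unfolding ab bb aa using v D(1) by (simp add: field_simps power2_eq_square)
  have 4: "M\<^sup>2 * D * ?\<tau> = (b * b) * (\<sigma> * r\<^sup>2 + (1 - \<gamma>) * r + \<tau>)"
    unfolding bb using D(1) by simp
  \<comment> \<open>The coefficient of the mixed term involves \<open>1 - ?\<gamma>\<close>, whereas
    the theorem gives \<open>?\<gamma>\<close> itself; hence the detour through
    \<open>D - D * ?\<gamma>\<close>.\<close>
  have "D * ?\<gamma> = v * \<gamma> - r * (v * \<sigma> + 1) - \<tau>" using D(1) by simp
  then have "D * (1 - ?\<gamma>) = D - (v * \<gamma> - r * (v * \<sigma> + 1) - \<tau>)"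
    by (simp only: right_diff_distrib mult_1_right)
  also have "\<dots> = 2 * \<sigma> * r * v + 2 * \<tau> + (1 - \<gamma>) * (v + r)"
    unfolding D(2) by (simp add: algebra_simps)
  finally have "M\<^sup>2 * D * (1 - ?\<gamma>) = M\<^sup>2 * (2 * \<sigma> * r * v + 2 * \<tau> + (1 - \<gamma>) * (v + r))"
    by (simp only: mult.assoc)
  then have 5: "M\<^sup>2 * D * (1 - ?\<gamma>) = 2 * \<sigma> * r * (b * b) + 2 * \<tau> * (a * b) + (1 - \<gamma>) * (b * b + r * (a * b))"
    unfolding ab bb by (simp add: algebra_simps)
  have "M\<^sup>2 * D * qh_K ?\<eta> ?\<theta> ?\<sigma> ?\<tau> ?\<gamma> x y =
      M\<^sup>2 * D + (M\<^sup>2 * D * ?\<eta>) * y + (M\<^sup>2 * D * ?\<theta>) * x + (M\<^sup>2 * D * ?\<sigma>) * y\<^sup>2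
      + (M\<^sup>2 * D * ?\<tau>) * x\<^sup>2 - (M\<^sup>2 * D * (1 - ?\<gamma>)) * x * y"
    by (rule qh_K_scaled)
  also have "\<dots> = qh_K \<eta> \<theta> \<sigma> \<tau> \<gamma> \<Delta> \<Delta>' +
      a * (v * \<eta> - \<theta> - 2 * \<tau> * \<Delta> + 2 * \<sigma> * v * \<Delta>' - (1 - \<gamma>) * (v * \<Delta> - \<Delta>')) * y
      + b * (\<theta> - r * \<eta> + 2 * \<tau> * \<Delta> - 2 * r * \<sigma> * \<Delta>' - (1 - \<gamma>) * (\<Delta>' - r * \<Delta>)) * x
      + (\<sigma> * (b * b) + (1 - \<gamma>) * (a * b) + \<tau> * (a * a)) * y\<^sup>2
      + (b * b) * (\<sigma> * r\<^sup>2 + (1 - \<gamma>) * r + \<tau>) * x\<^sup>2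
      - (2 * \<sigma> * r * (b * b) + 2 * \<tau> * (a * b) + (1 - \<gamma>) * (b * b + r * (a * b))) * x * y"
    unfolding 1 2 3 4 5 K ..
  also have "\<dots> = qh_K \<eta> \<theta> \<sigma> \<tau> \<gamma> (a * (v * x - y) + \<Delta>) (b * (y - r * x) + \<Delta>')"
    unfolding qh_K_def av[symmetric] by (simp add: algebra_simps power2_eq_square)
  finally show ?thesis by (simp add: a_def b_def)
qed

section \<open>The Moebius time change\<close>

text \<open>The Moebius map of \<open>A\<close>, whose common scalar factor cancels. It sends 0 to
  \<open>r\<close> and infinity to \<open>v\<close>, with pole at \<open>-v\<close>.\<close>

definition time_change :: "real \<Rightarrow> real \<Rightarrow> real \<Rightarrow> real" where
  "time_change r v t = (t + r) / (1 + t / v)"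

lemma time_change_eq: "0 < v \<Longrightarrow> time_change r v t = v * (t + r) / (v + t)"
  by (simp add: time_change_def field_simps)

lemma time_change_diff:
  assumes "0 < v" "0 < v + s" "0 < v + t"
  shows "time_change r v t - time_change r v s = v * (v - r) * (t - s) / ((v + s) * (v + t))"
proof -
  have "time_change r v t - time_change r v s =
      (v * (t + r) * (v + s) - v * (s + r) * (v + t)) / ((v + t) * (v + s))"
    using assms by (simp add: time_change_eq diff_frac_eq)
  also have "v * (t + r) * (v + s) - v * (s + r) * (v + t) = v * (v - r) * (t - s)"
    by (simp add: algebra_simps)
  finally show ?thesis by (simp add: mult.commute)
qed

lemma time_change_minus_left:
  assumes "0 < v" "v + t \<noteq> 0"
  shows "time_change r v t - r = t * (v - r) / (v + t)"
  using assms by (simp add: time_change_eq field_simps)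

lemma time_change_minus_right:
  assumes "0 < v" "v + t \<noteq> 0"
  shows "v - time_change r v t = v * (v - r) / (v + t)"
  using assms by (simp add: time_change_eq field_simps)

text \<open>The expression \<open>v * (x - r) / (v - x)\<close> comes from solving
  \<open>x = v * (t + r) / (v + t)\<close> for \<open>t\<close>.\<close>

lemma time_change_inverse:
  assumes "0 < v" "r < v" "x \<noteq> v"
  shows "v + v * (x - r) / (v - x) \<noteq> 0" "time_change r v (v * (x - r) / (v - x)) = x"
proof -
  have x: "v - x \<noteq> 0" using assms by simp
  then have s: "v + v * (x - r) / (v - x) = v * (v - r) / (v - x)"
    by (simp add: field_simps)
  then show nz: "v + v * (x - r) / (v - x) \<noteq> 0" using assms x by simp
  have "v - time_change r v (v * (x - r) / (v - x)) = v - x"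
    unfolding time_change_minus_right[OF assms(1) nz] s using assms x by simp
  then show "time_change r v (v * (x - r) / (v - x)) = x" by simp
qed

text \<open>All \<open>t\<close> off the pole are covered, since the time set of the transform is a
  full preimage: for \<open>t < -v\<close> the image lies above \<open>v\<close>, and for
  \<open>-v < t \<le> 0\<close> it is at most \<open>r\<close>.\<close>

lemma time_change_in_iff:
  assumes "0 < v" "r < v" "v + t \<noteq> 0"
  shows "time_change r v t \<in> {r<..<v} \<longleftrightarrow> 0 < t"
proof -
  have "time_change r v t < v \<longleftrightarrow> 0 < v + t"
    using time_change_minus_right[OF assms(1,3), of r] assms
    by (smt (verit) zero_less_divide_iff mult_pos_pos)
  moreover have "r < time_change r v t \<longleftrightarrow> 0 < t" if "0 < v + t"
    using time_change_minus_left[OF assms(1,3), of r] assms that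
    by (smt (verit) zero_less_divide_iff zero_less_mult_iff)
  ultimately show ?thesis using assms(1) by auto
qed

lemma bij_betw_time_change:
  assumes "0 < v" "r < v"
  shows "bij_betw (time_change r v) {0<..} {r<..<v}"
proof (rule bij_betw_byWitness[where f' = "\<lambda>x. v * (x - r) / (v - x)"])
  show "\<forall>t\<in>{0<..}. v * (time_change r v t - r) / (v - time_change r v t) = t"
  proof
    fix t :: real assume "t \<in> {0<..}"
    then have t: "v + t \<noteq> 0" using assms by auto
    have cancel: "v * (t * p / w) / (v * p / w) = t" if "p \<noteq> 0" "w \<noteq> 0" for p w
      using that assms by (simp add: field_simps)
    show "v * (time_change r v t - r) / (v - time_change r v t) = t"
      unfolding time_change_minus_right[OF assms(1) t] time_change_minus_left[OF assms(1) t]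
      using t assms by (intro cancel) auto
  qed
  show "\<forall>x\<in>{r<..<v}. time_change r v (v * (x - r) / (v - x)) = x"
    using time_change_inverse(2)[OF assms] by auto
  show "time_change r v ` {0<..} \<subseteq> {r<..<v}"
    using time_change_in_iff[OF assms] assms by fastforce
  show "(\<lambda>x. v * (x - r) / (v - x)) ` {r<..<v} \<subseteq> {0<..}"
    using assms by auto
qed

lemma time_change_less_iff:
  assumes "0 < v" "r < v" "0 < s" "0 < t"
  shows "time_change r v s < time_change r v t \<longleftrightarrow> s < t"
  using time_change_diff[of v s t r] assms
  by (smt (verit) zero_less_divide_iff zero_less_mult_iff)

section \<open>The rescaled process \<open>Y\<close>\<close>

context quadratic_harness_bridge
begin

context
  fixes M c :: real and Y :: "real \<Rightarrow> 'b \<Rightarrow> real"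
  assumes M: "M \<noteq> 0" "M\<^sup>2 * den r v = K_at r v z\<^sub>r z\<^sub>v"
    and c: "c = sqrt v / ((v - r) * M)"
    and Y: "\<And>t \<omega>. 0 < t \<Longrightarrow>
      Y t \<omega> = c * ((1 + t / v) * X (time_change r v t) \<omega> - (t * (z\<^sub>v / v) + z\<^sub>r))"
begin

abbreviation \<phi> :: "real \<Rightarrow> real" where "\<phi> \<equiv> time_change r v"

text \<open>Equal to \<open>c * (v - r) / (v - time_change r v t)\<close> for positive
  \<open>t\<close>: division by the distance to \<open>v\<close> offsets the linear decay of the
  covariance in the later time.\<close>

definition amp :: "real \<Rightarrow> real" where "amp t = c * (1 + t / v)"

lemma v_pos: "0 < v" using v_T T_pos by auto

text \<open>The second equation is the normalization that gives \<open>Y t\<close> the variance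
  \<open>t\<close>. It involves only squares, so either sign of \<open>M\<close> is
  possible.\<close>

lemma c_neq_0: "c \<noteq> 0" and c_sq: "c\<^sup>2 * (v - r)\<^sup>2 * M\<^sup>2 = v"
  using v_pos r_less_v M(1) by (simp_all add: c power_divide power_mult_distrib)

lemma \<phi>_less: "0 < s \<Longrightarrow> 0 < t \<Longrightarrow> \<phi> s < \<phi> t \<longleftrightarrow> s < t"
  by (rule time_change_less_iff[OF v_pos r_less_v])

lemma \<phi>_in: "0 < t \<Longrightarrow> r < \<phi> t" "0 < t \<Longrightarrow> \<phi> t < v"
  using time_change_in_iff[OF v_pos r_less_v, of t] v_pos by auto

text \<open>The affine term subtracted in \<open>Y\<close> is exactly the rescaled chord, so
  \<open>Y\<close> is a multiple of the time-changed deviation \<open>W\<close>.\<close>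

lemma amp_line: "0 < t \<Longrightarrow> amp t * line (\<phi> t) = c * (t * (z\<^sub>v / v) + z\<^sub>r)"
proof -
  assume t: "0 < t"
  have vt: "v + t \<noteq> 0" "v - r \<noteq> 0" using t v_pos r_less_v by auto
  have "line (\<phi> t) = (v * z\<^sub>r + t * z\<^sub>v) / (v + t)"
    unfolding line_def interp_def time_change_minus_left[OF v_pos vt(1)]
      time_change_minus_right[OF v_pos vt(1)] using vt by (simp add: add_divide_distrib)
  moreover have "amp t = c * (v + t) / v" using v_pos by (simp add: amp_def field_simps)
  ultimately have "amp t * line (\<phi> t) = c * (v * z\<^sub>r + t * z\<^sub>v) / v" using vt by simp
  also have "\<dots> = c * (t * (z\<^sub>v / v) + z\<^sub>r)" using v_pos by (simp add: field_simps)
  finally show ?thesis .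
qed

lemma Y_X: "0 < t \<Longrightarrow> Y t \<omega> = amp t * X (\<phi> t) \<omega> + - (amp t * line (\<phi> t))"
  using amp_line[of t] by (simp add: Y amp_def algebra_simps)

lemma Y_W: "0 < t \<Longrightarrow> Y t \<omega> = amp t * W (\<phi> t) \<omega>"
  using Y_X[of t \<omega>] by (simp add: W_def algebra_simps)

lemma Y_fun: "0 < t \<Longrightarrow> Y t = (\<lambda>\<omega>. amp t * W (\<phi> t) \<omega>)"
  using Y_W by blast

lemma amp_neq_0: "0 < t \<Longrightarrow> amp t \<noteq> 0"
  using c_neq_0 v_pos by (simp add: amp_def add_pos_pos less_imp_neq[symmetric])

text \<open>The time change is increasing, so it carries the times outside \<open>(s, u)\<close>
  onto those outside the image interval, and the scaling is invertible at each time.\<close>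

lemma natural_filtration_Y:
  assumes "0 < s" "0 < u"
  shows "natural_filtration Q {0<..} Y s u = natural_filtration Q {r<..<v} X (\<phi> s) (\<phi> u)"
  unfolding natural_filtration_def
proof (rule process_sigma_time_change[where a = amp and b = "\<lambda>t. - (amp t * line (\<phi> t))"])
  show "bij_betw \<phi> {ra \<in> {0<..}. ra \<le> s \<or> u \<le> ra} {ra \<in> {r<..<v}. ra \<le> \<phi> s \<or> \<phi> u \<le> ra}"
    using assms by (intro bij_betw_Collect[OF bij_betw_time_change[OF v_pos r_less_v]])
      (simp add: \<phi>_less flip: not_less)
qed (use amp_neq_0 Y_X in auto)

lemma measurable_Y: "0 < t \<Longrightarrow> Y t \<in> borel_measurable Q"
  using measurable_W[OF \<phi>_in] by (simp add: Y_fun)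

lemma square_integrable_Y: "0 < t \<Longrightarrow> integrable Q (\<lambda>\<omega>. (Y t \<omega>)\<^sup>2)"
  using square_integrable_W[OF \<phi>_in] by (simp add: Y_W power_mult_distrib)

lemma integrable_Y: "0 < t \<Longrightarrow> integrable Q (Y t)"
  using integrable_W[OF \<phi>_in, of t] by (simp add: Y_fun)

lemma mean_Y: "0 < t \<Longrightarrow> (\<integral>\<omega>. Y t \<omega> \<partial>Q) = 0"
  using mean_W[OF \<phi>_in, of t] by (simp add: Y_W)

text \<open>The two factors \<open>v + t\<close> in the denominator of \<open>bridge_var\<close>
  cancel against \<open>amp\<close>; the remaining constant is 1 by \<open>c_sq\<close>.\<close>

lemma scaled_variance_Y: "0 < t \<Longrightarrow> amp t * amp t * q (\<phi> t) (\<phi> t) = t"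
proof -
  assume t: "0 < t"
  have vt: "v + t \<noteq> 0" using t v_pos by simp
  have "bridge_var (\<phi> t) = (t * (v - r) / (v + t)) * (v * (v - r) / (v + t)) * M\<^sup>2"
    unfolding bridge_var_def time_change_minus_left[OF v_pos vt] time_change_minus_right[OF v_pos vt]
      M(2)[symmetric] using den_pos by simp
  moreover have "amp t = c * (v + t) / v" using v_pos by (simp add: amp_def field_simps)
  ultimately have "amp t * amp t * q (\<phi> t) (\<phi> t) = (c\<^sup>2 * (v - r)\<^sup>2 * M\<^sup>2) * t / v"
    using vt v_pos by (simp add: q_diag[OF \<phi>_in[OF t]] power2_eq_square)
  then show ?thesis unfolding c_sq using v_pos by simp
qed

text \<open>The decay factor of the covariance becomes \<open>(v + s) / (v + t)\<close>, which turns
  \<open>amp t\<close> into \<open>amp s\<close>; what is left is the variance at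
  \<open>s\<close>.\<close>

lemma coscaled_variance_Y_le:
  assumes "0 < s" "s \<le> t"
  shows "(\<integral>\<omega>. Y s \<omega> * Y t \<omega> \<partial>Q) = s"
proof -
  have t: "0 < t" using assms by simp
  have vt: "v + t \<noteq> 0" "v + s \<noteq> 0" using t v_pos assms by auto
  have eq: "(\<integral>\<omega>. Y s \<omega> * Y t \<omega> \<partial>Q) = amp s * amp t * q (\<phi> s) (\<phi> t)"
    by (simp add: Y_W assms t mult.assoc mult.left_commute flip: integral_mult_right_zero)
  show ?thesis
  proof (cases "s = t")
    case True
    then show ?thesis using eq scaled_variance_Y[OF t] by simp
  next
    case False
    then have "\<phi> s < \<phi> t" using assms t by (simp add: \<phi>_less)
    then have "q (\<phi> s) (\<phi> t) = (v - \<phi> t) / (v - \<phi> s) * q (\<phi> s) (\<phi> s)"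
      by (intro q_eq_of_less \<phi>_in assms t)
    also have "(v - \<phi> t) / (v - \<phi> s) = (v + s) / (v + t)"
      unfolding time_change_minus_right[OF v_pos vt(1)] time_change_minus_right[OF v_pos vt(2)]
      using v_pos r_less_v vt by simp
    finally have "amp s * amp t * q (\<phi> s) (\<phi> t) =
        amp s * (amp t * ((v + s) / (v + t))) * q (\<phi> s) (\<phi> s)" by simp
    also have "amp t * ((v + s) / (v + t)) = amp s"
    proof -
      have "amp x = c * (v + x) / v" for x using v_pos by (simp add: amp_def field_simps)
      then show ?thesis using vt v_pos by simp
    qed
    finally show ?thesis using eq scaled_variance_Y[OF assms(1)] by simp
  qed
qed

lemma coscaled_variance_Y:
  assumes "0 < s" "0 < t"
  shows "(\<integral>\<omega>. Y s \<omega> * Y t \<omega> \<partial>Q) = min s t"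
  using coscaled_variance_Y_le[of s t] coscaled_variance_Y_le[of t s] assms
  by (cases "s \<le> t") (auto simp: mult.commute)

context
  fixes s t u :: real
  assumes stu: "0 < s" "s < t" "t < u"
begin

lemma \<phi>_stu: "r < \<phi> s" "\<phi> s < \<phi> t" "\<phi> t < \<phi> u" "\<phi> u < v"
  using stu by (auto simp: \<phi>_less intro: \<phi>_in)

text \<open>Multiplying by \<open>amp\<close> after the time change sends affine functions of time
  to affine functions, so it commutes with linear interpolation.\<close>

lemma interp_Y:
  "interp s t u (Y s \<omega>) (Y u \<omega>) = amp t * interp (\<phi> s) (\<phi> t) (\<phi> u) (W (\<phi> s) \<omega>) (W (\<phi> u) \<omega>)"
proof -
  have pos: "0 < v + s" "0 < v + t" "0 < v + u" "u - s \<noteq> 0" "v - r \<noteq> 0" "0 < u"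
    using stu v_pos r_less_v by auto
  have sc: "amp x = c * (v + x) / v" for x using v_pos by (simp add: amp_def field_simps)
  have 1: "amp t * ((\<phi> u - \<phi> t) / (\<phi> u - \<phi> s)) = (u - t) / (u - s) * amp s"
    unfolding sc time_change_diff[OF v_pos pos(2,3)] time_change_diff[OF v_pos pos(1,3)]
    using pos v_pos by (simp add: divide_simps)
  have 2: "amp t * ((\<phi> t - \<phi> s) / (\<phi> u - \<phi> s)) = (t - s) / (u - s) * amp u"
    unfolding sc time_change_diff[OF v_pos pos(1,2)] time_change_diff[OF v_pos pos(1,3)]
    using pos v_pos by (simp add: divide_simps)
  have "amp t * interp (\<phi> s) (\<phi> t) (\<phi> u) (W (\<phi> s) \<omega>) (W (\<phi> u) \<omega>) =
      amp t * ((\<phi> u - \<phi> t) / (\<phi> u - \<phi> s)) * W (\<phi> s) \<omega> + amp t * ((\<phi> t - \<phi> s) / (\<phi> u - \<phi> s)) * W (\<phi> u) \<omega>"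
    unfolding interp_def distrib_left mult.assoc ..
  then show ?thesis
    unfolding 1 2 using stu pos by (simp add: interp_def Y_W)
qed

text \<open>If the line through the two values of \<open>Y\<close> has slope \<open>x\<close> and
  intercept \<open>y\<close>, the corresponding line for \<open>W\<close> has slope
  \<open>M / sqrt v * (v * x - y)\<close> and intercept \<open>M * sqrt v * (y - r * x)\<close>:
  this inverts the linear action of the transformation on affine functions.\<close>

lemma K_at_Y:
  "K_at (\<phi> s) (\<phi> u) (X (\<phi> s) \<omega>) (X (\<phi> u) \<omega>) =
    qh_K \<eta> \<theta> \<sigma> \<tau> \<gamma>
      (M / sqrt v * (v * ((Y u \<omega> - Y s \<omega>) / (u - s)) - (u * Y s \<omega> - s * Y u \<omega>) / (u - s)) + slope)
      (M * sqrt v * ((u * Y s \<omega> - s * Y u \<omega>) / (u - s) - r * ((Y u \<omega> - Y s \<omega>) / (u - s))) + icpt)"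
proof -
  have pos: "0 < v + s" "0 < v + u" "0 < u - s" "v - r \<noteq> 0" "0 < u"
    using stu v_pos r_less_v by auto
  \<comment> \<open>Clears denominators: \<open>Y s\<close> becomes a multiple of
    \<open>(v + s)\<^sup>2 * x\<close>, and the identities reduce to polynomial ones.\<close>
  define x where "x = W (\<phi> s) \<omega> / (v + s)"
  define y where "y = W (\<phi> u) \<omega> / (v + u)"
  have W: "W (\<phi> s) \<omega> = x * (v + s)" "W (\<phi> u) \<omega> = y * (v + u)"
    using pos by (simp_all add: x_def y_def)
  have sc: "amp x = c * (v + x) / v" for x using v_pos by (simp add: amp_def field_simps)
  have sv: "sqrt v * sqrt v = v" "sqrt v > 0" using v_pos by auto
  have Mc: "M / sqrt v * c = 1 / (v - r)" "M * sqrt v * c = v / (v - r)"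
    using sv M(1) pos by (simp_all add: c)
  have d: "\<phi> u - \<phi> s = v * (v - r) * (u - s) / ((v + s) * (v + u))"
    by (rule time_change_diff[OF v_pos pos(1,2)])
  have ph: "\<phi> s = v * (s + r) / (v + s)" "\<phi> u = v * (u + r) / (v + u)"
    by (rule time_change_eq[OF v_pos])+
  have Y': "Y s \<omega> = c * (((v + s)\<^sup>2 * x) / v)" "Y u \<omega> = c * (((v + u)\<^sup>2 * y) / v)"
    using stu pos by (simp_all add: Y_W sc W power2_eq_square)
  have gen: "g * (v * ((c * (b / v) - c * (a / v)) / e) - (u * (c * (a / v)) - s * (c * (b / v))) / e) =
      (g * c) * ((v * (b - a) - (u * a - s * b)) / (v * e))"
    "g * ((u * (c * (a / v)) - s * (c * (b / v))) / e - r * ((c * (b / v) - c * (a / v)) / e)) =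
      (g * c) * (((u * a - s * b) - r * (b - a)) / (v * e))"
    if "e \<noteq> 0" for g a b e
    using v_pos that by (simp_all add: field_simps)
  have us: "u - s \<noteq> 0" using pos by simp
  have "M / sqrt v * (v * ((Y u \<omega> - Y s \<omega>) / (u - s)) - (u * Y s \<omega> - s * Y u \<omega>) / (u - s)) =
      (M / sqrt v * c) * ((v * ((v + u)\<^sup>2 * y - (v + s)\<^sup>2 * x) - (u * ((v + s)\<^sup>2 * x) - s * ((v + u)\<^sup>2 * y))) / (v * (u - s)))"
    unfolding Y' by (rule gen(1)[OF us])
  also have "v * ((v + u)\<^sup>2 * y - (v + s)\<^sup>2 * x) - (u * ((v + s)\<^sup>2 * x) - s * ((v + u)\<^sup>2 * y)) =
      (v + s) * (v + u) * (W (\<phi> u) \<omega> - W (\<phi> s) \<omega>)"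
    unfolding W by (simp add: algebra_simps power2_eq_square)
  also have "(M / sqrt v * c) * ((v + s) * (v + u) * (W (\<phi> u) \<omega> - W (\<phi> s) \<omega>) / (v * (u - s))) =
      (W (\<phi> u) \<omega> - W (\<phi> s) \<omega>) / (\<phi> u - \<phi> s)"
    unfolding Mc d by (simp add: mult.assoc mult.left_commute mult.commute)
  finally have 1: "(W (\<phi> u) \<omega> - W (\<phi> s) \<omega>) / (\<phi> u - \<phi> s) =
    M / sqrt v * (v * ((Y u \<omega> - Y s \<omega>) / (u - s)) - (u * Y s \<omega> - s * Y u \<omega>) / (u - s))" ..
  have "M * sqrt v * ((u * Y s \<omega> - s * Y u \<omega>) / (u - s) - r * ((Y u \<omega> - Y s \<omega>) / (u - s))) =
      (M * sqrt v * c) * (((u * ((v + s)\<^sup>2 * x) - s * ((v + u)\<^sup>2 * y)) - r * ((v + u)\<^sup>2 * y - (v + s)\<^sup>2 * x)) / (v * (u - s)))"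
    unfolding Y' by (rule gen(2)[OF us])
  also have "(u * ((v + s)\<^sup>2 * x) - s * ((v + u)\<^sup>2 * y)) - r * ((v + u)\<^sup>2 * y - (v + s)\<^sup>2 * x) =
      (u + r) * (v + s)\<^sup>2 * x - (s + r) * (v + u)\<^sup>2 * y"
    by (simp add: algebra_simps)
  also have "(M * sqrt v * c) * (((u + r) * (v + s)\<^sup>2 * x - (s + r) * (v + u)\<^sup>2 * y) / (v * (u - s))) =
      v * ((u + r) * (v + s)\<^sup>2 * x - (s + r) * (v + u)\<^sup>2 * y) / ((v + s) * (v + u)) / (\<phi> u - \<phi> s)"
    unfolding Mc d using pos v_pos by (simp add: mult.assoc mult.left_commute mult.commute)
  also have "v * ((u + r) * (v + s)\<^sup>2 * x - (s + r) * (v + u)\<^sup>2 * y) / ((v + s) * (v + u)) =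
      \<phi> u * W (\<phi> s) \<omega> - \<phi> s * W (\<phi> u) \<omega>"
    unfolding W unfolding ph using pos by (simp add: field_simps power2_eq_square)
  finally have 2: "(\<phi> u * W (\<phi> s) \<omega> - \<phi> s * W (\<phi> u) \<omega>) / (\<phi> u - \<phi> s) =
    M * sqrt v * ((u * Y s \<omega> - s * Y u \<omega>) / (u - s) - r * ((Y u \<omega> - Y s \<omega>) / (u - s)))" ..
  have "\<phi> s < \<phi> u" using \<phi>_stu by simp
  then show ?thesis unfolding K_at_X[OF \<open>\<phi> s < \<phi> u\<close>] 1 2 by (intro refl)
qed

lemma cond_exp_Y:
  "AE \<omega> in Q. real_cond_exp Q (natural_filtration Q {0<..} Y s u) (Y t) \<omega> = interp s t u (Y s \<omega>) (Y u \<omega>)"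
  "AE \<omega> in Q. real_cond_exp Q (natural_filtration Q {0<..} Y s u) (\<lambda>\<omega>. (Y t \<omega>)\<^sup>2) \<omega> =
    (interp s t u (Y s \<omega>) (Y u \<omega>))\<^sup>2 +
    (amp t)\<^sup>2 * C (\<phi> t) (\<phi> s) (\<phi> u) * K_at (\<phi> s) (\<phi> u) (X (\<phi> s) \<omega>) (X (\<phi> u) \<omega>)"
proof -
  let ?G = "natural_filtration Q {0<..} Y s u"
  have pos: "0 < t" "0 < u" using stu by auto
  have G: "?G = natural_filtration Q {r<..<v} X (\<phi> s) (\<phi> u)"
    by (rule natural_filtration_Y[OF stu(1) pos(2)])
  interpret prob_space Q by (rule prob_space_Q)
  interpret finite_measure_subalgebra Q ?G
    by unfold_locales (unfold natural_filtration_def, rule subalgebra_process_sigma, simp add: measurable_Y)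
  have Xi: "integrable Q (X (\<phi> t))" by (rule integrable_X[OF \<phi>_in[OF pos(1)]])
  have "AE \<omega> in Q. real_cond_exp Q ?G (\<lambda>\<omega>. amp t * X (\<phi> t) \<omega> + - (amp t * line (\<phi> t))) \<omega> =
      real_cond_exp Q ?G (\<lambda>\<omega>. amp t * X (\<phi> t) \<omega>) \<omega> + real_cond_exp Q ?G (\<lambda>\<omega>. - (amp t * line (\<phi> t))) \<omega>"
    using Xi by (intro real_cond_exp_add) auto
  moreover have "AE \<omega> in Q. real_cond_exp Q ?G (\<lambda>\<omega>. amp t * X (\<phi> t) \<omega>) \<omega> =
      amp t * real_cond_exp Q ?G (X (\<phi> t)) \<omega>"
    using Xi by (rule real_cond_exp_cmult)
  moreover have "AE \<omega> in Q. real_cond_exp Q ?G (\<lambda>\<omega>. - (amp t * line (\<phi> t))) \<omega> = - (amp t * line (\<phi> t))"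
    by (rule real_cond_exp_F_meas) auto
  moreover have "Y t = (\<lambda>\<omega>. amp t * X (\<phi> t) \<omega> + - (amp t * line (\<phi> t)))"
    using Y_X[OF pos(1)] by auto
  ultimately show "AE \<omega> in Q. real_cond_exp Q ?G (Y t) \<omega> = interp s t u (Y s \<omega>) (Y u \<omega>)"
    using cond_exp_X_nat(1)[OF \<phi>_stu, folded G] \<phi>_stu
    by (elim AE_mp) (auto simp: interp_Y interp_X algebra_simps intro!: AE_I2)
  \<comment> \<open>The shifted square of \<open>X\<close> about the chord is, up to a constant
    factor, the square of \<open>Y t\<close>; hence the choice of the shift below.\<close>
  have Y2: "(\<lambda>\<omega>. (Y t \<omega>)\<^sup>2) = (\<lambda>\<omega>. (amp t)\<^sup>2 * (X (\<phi> t) \<omega> - line (\<phi> t))\<^sup>2)"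
    by (simp add: Y_W[OF pos(1)] W_def power_mult_distrib)
  have "AE \<omega> in Q. real_cond_exp Q ?G (\<lambda>\<omega>. (Y t \<omega>)\<^sup>2) \<omega> =
      (amp t)\<^sup>2 * real_cond_exp Q ?G (\<lambda>\<omega>. (X (\<phi> t) \<omega> - line (\<phi> t))\<^sup>2) \<omega>"
    unfolding Y2 using integrable_X_shift_sq[OF \<phi>_in[OF pos(1)]] by (rule real_cond_exp_cmult)
  with cond_exp_X_nat(2)[OF \<phi>_stu, of "line (\<phi> t)", folded G]
  show "AE \<omega> in Q. real_cond_exp Q ?G (\<lambda>\<omega>. (Y t \<omega>)\<^sup>2) \<omega> =
    (interp s t u (Y s \<omega>) (Y u \<omega>))\<^sup>2 +
    (amp t)\<^sup>2 * C (\<phi> t) (\<phi> s) (\<phi> u) * K_at (\<phi> s) (\<phi> u) (X (\<phi> s) \<omega>) (X (\<phi> u) \<omega>)"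
  proof eventually_elim
    case (elim \<omega>)
    have "\<phi> s < \<phi> u" using \<phi>_stu by simp
    from elim show ?case
      by (simp add: interp_Y interp_X[OF \<open>\<phi> s < \<phi> u\<close>] power_mult_distrib distrib_left)
  qed
qed

lemma cond_var_Y:
  "AE \<omega> in Q. cond_var Q (natural_filtration Q {0<..} Y s u) (Y t) \<omega> =
    (amp t)\<^sup>2 * C (\<phi> t) (\<phi> s) (\<phi> u) * K_at (\<phi> s) (\<phi> u) (X (\<phi> s) \<omega>) (X (\<phi> u) \<omega>)"
proof (rule cond_var_eqI[OF prob_space_Q _ _ _ _ _ cond_exp_Y])
  have pos: "0 < t" "0 < u" using stu by auto
  show "subalgebra Q (natural_filtration Q {0<..} Y s u)"
    unfolding natural_filtration_def by (rule subalgebra_process_sigma) (simp add: measurable_Y)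
  have [measurable]: "Y s \<in> borel_measurable (natural_filtration Q {0<..} Y s u)"
    "Y u \<in> borel_measurable (natural_filtration Q {0<..} Y s u)"
    unfolding natural_filtration_def using stu by (auto intro!: measurable_process_sigma)
  show "(\<lambda>\<omega>. interp s t u (Y s \<omega>) (Y u \<omega>)) \<in> borel_measurable (natural_filtration Q {0<..} Y s u)"
    unfolding interp_def by measurable
  show "integrable Q (\<lambda>\<omega>. (interp s t u (Y s \<omega>) (Y u \<omega>))\<^sup>2)"
    using integral_affine_mult(1)[OF prob_space_Q measurable_Y measurable_Y square_integrable_Y
      square_integrable_Y, OF stu(1) pos(2) stu(1) pos(2), of "(u - t) / (u - s)" "(t - s) / (u - s)" 0
      "(u - t) / (u - s)" "(t - s) / (u - s)" 0]
    by (simp add: interp_def power2_eq_square)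
qed (use stu in \<open>auto intro: measurable_Y square_integrable_Y\<close>)

end

lemma QH_Y:
  "QH Q {0<..} (natural_filtration Q {0<..} Y)
     ((v * \<eta> - \<theta> - 2 * \<tau> * slope + 2 * \<sigma> * v * icpt - (1 - \<gamma>) * (v * slope - icpt)) / (sqrt v * M * den r v))
     (sqrt v * (\<theta> - r * \<eta> + 2 * \<tau> * slope - 2 * r * \<sigma> * icpt - (1 - \<gamma>) * (icpt - r * slope)) / (M * den r v))
     ((\<sigma> * v\<^sup>2 + (1 - \<gamma>) * v + \<tau>) / (v * den r v))
     (v * ((\<sigma> * r\<^sup>2 + (1 - \<gamma>) * r + \<tau>) / den r v))
     ((v * \<gamma> - r * (v * \<sigma> + 1) - \<tau>) / den r v) Y"
    (is "QH _ _ _ ?\<eta> ?\<theta> ?\<sigma> ?\<tau> ?\<gamma> _")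
proof -
  have stoch: "stoch_process Q {0<..} Y"
    unfolding stoch_process_def using prob_space_Q measurable_Y by auto
  have oi: "open_interval {0::real<..}"
    unfolding open_interval_def is_interval_1 by (auto intro: exI[of _ 1])
  have harn: "harness Q {0<..} (natural_filtration Q {0<..} Y) Y"
    unfolding harness_def
  proof (intro conjI ballI impI oi stoch past_future_filtration_natural[OF stoch])
    fix s t :: real assume "s \<in> {0<..}" "t \<in> {0<..}"
    then show "Y s \<in> borel_measurable (natural_filtration Q {0<..} Y s t)"
      "Y t \<in> borel_measurable (natural_filtration Q {0<..} Y s t)"
      unfolding natural_filtration_def by (auto intro!: measurable_process_sigma)
  next
    fix s t u :: real assume "s \<in> {0<..}" "s < t \<and> t < u"
    then show "AE \<omega> in Q. real_cond_exp Q (natural_filtration Q {0<..} Y s u) (Y t) \<omega> =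
      (u - t) / (u - s) * Y s \<omega> + (t - s) / (u - s) * Y u \<omega>"
      using cond_exp_Y(1)[of s t u] by (simp add: interp_def)
  qed (simp add: integrable_Y)
  have K0: "qh_K \<eta> \<theta> \<sigma> \<tau> \<gamma> slope icpt = M\<^sup>2 * den r v"
    unfolding M(2) slope_def icpt_def ..
  have "AE \<omega> in Q. cond_var Q (natural_filtration Q {0<..} Y s u) (Y t) \<omega> =
      (amp t)\<^sup>2 * C (\<phi> t) (\<phi> s) (\<phi> u) * (M\<^sup>2 * den r v) * qh_K ?\<eta> ?\<theta> ?\<sigma> ?\<tau> ?\<gamma>
        ((Y u \<omega> - Y s \<omega>) / (u - s)) ((u * Y s \<omega> - s * Y u \<omega>) / (u - s))"
    if "0 < s" "s < t" "t < u" for s t u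
    using cond_var_Y[OF that] den_pos
    unfolding K_at_Y[OF that] qh_K_affine[OF v_pos M(1) less_imp_neq[OF den_pos, symmetric] den_def K0]
    by (simp only: mult.assoc)
  then have "\<exists>C :: real \<Rightarrow> real \<Rightarrow> real \<Rightarrow> real. \<forall>s\<in>{0<..}. \<forall>t\<in>{0<..}. \<forall>u\<in>{0<..}. s < t \<and> t < u \<longrightarrow>
      (AE \<omega> in Q. cond_var Q (natural_filtration Q {0<..} Y s u) (Y t) \<omega> =
        C t s u * qh_K ?\<eta> ?\<theta> ?\<sigma> ?\<tau> ?\<gamma>
          ((Y u \<omega> - Y s \<omega>) / (u - s)) ((u * Y s \<omega> - s * Y u \<omega>) / (u - s)))"
    \<comment> \<open>The new variance factor: \<open>(amp t)\<^sup>2\<close> from the scaling, the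
      old factor at the transformed times, and the constant pulled out of \<open>K\<close> when its
      constant term was normalized.\<close>
    by (intro exI[of _ "\<lambda>t s u. (amp t)\<^sup>2 * C (\<phi> t) (\<phi> s) (\<phi> u) * (M\<^sup>2 * den r v)"]) auto
  then show ?thesis
    unfolding QH_def using harn square_integrable_Y mean_Y coscaled_variance_Y by simp
qed

end

end

theorem theorem2p2:
  fixes P :: "'a measure" and Q :: "'b measure"
    and T :: "real set"
    and Z :: "real \<Rightarrow> 'a \<Rightarrow> real" and X :: "real \<Rightarrow> 'b \<Rightarrow> real"
    and \<eta> \<theta> \<sigma> \<tau> \<gamma> r v z\<^sub>r z\<^sub>v \<Delta> \<Delta>' K D :: real
  assumes "QH P T (natural_filtration P T Z) \<eta> \<theta> \<sigma> \<tau> \<gamma> Z"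
    and "r \<in> T" and "v \<in> T" and "r < v"
    and "bridge P T Z r z\<^sub>r v z\<^sub>v Q X"
    and "\<Delta> = (z\<^sub>v - z\<^sub>r) / (v - r)"
    and "\<Delta>' = (v * z\<^sub>r - r * z\<^sub>v) / (v - r)"
    and "K = qh_K \<eta> \<theta> \<sigma> \<tau> \<gamma> \<Delta> \<Delta>'"
    and "K > 0"
    and "D = v * (1 + r * \<sigma>) + \<tau> - r * \<gamma>"
  shows "D > 0 \<and>
    (\<forall>(M::real) (A::real^2^2) (m::real^2) Y.
       M\<^sup>2 = K / D \<and>
       A = (sqrt v / ((v - r) * M)) *\<^sub>R vector [vector [1, r], vector [1 / v, 1]] \<and>
       m = (- (sqrt v / ((v - r) * M))) *\<^sub>R vector [z\<^sub>v / v, z\<^sub>r] \<and>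
       Y = f_transform A m X \<longrightarrow>
       f_transform_defined A {r<..<v} \<and>
       f_transform_times A {r<..<v} = {0<..} \<and>
       (\<forall>t>0. \<forall>\<omega>\<in>space Q.
          Y t \<omega> = sqrt v / ((v - r) * M) *
            ((1 + t / v) * X ((t + r) / (1 + t / v)) \<omega> - (t * (z\<^sub>v / v) + z\<^sub>r))) \<and>
       QH Q {0<..} (natural_filtration Q {0<..} Y)
         ((v * \<eta> - \<theta> - 2 * \<tau> * \<Delta> + 2 * \<sigma> * v * \<Delta>' - (1 - \<gamma>) * (v * \<Delta> - \<Delta>')) / (sqrt v * M * D))
         (sqrt v * (\<theta> - r * \<eta> + 2 * \<tau> * \<Delta> - 2 * r * \<sigma> * \<Delta>' - (1 - \<gamma>) * (\<Delta>' - r * \<Delta>)) / (M * D))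
         ((\<sigma> * v\<^sup>2 + (1 - \<gamma>) * v + \<tau>) / (v * D))
         (v * ((\<sigma> * r\<^sup>2 + (1 - \<gamma>) * r + \<tau>) / D))
         ((v * \<gamma> - r * (v * \<sigma> + 1) - \<tau>) / D)
         Y)"
proof -
  from assms(1) obtain C where "quadratic_harness P T Z \<eta> \<theta> \<sigma> \<tau> \<gamma> C"
    unfolding QH_def quadratic_harness_def by fast
  then interpret quadratic_harness P T Z \<eta> \<theta> \<sigma> \<tau> \<gamma> C .
  interpret quadratic_harness_bridge P T Z \<eta> \<theta> \<sigma> \<tau> \<gamma> C Q X r v z\<^sub>r z\<^sub>v
    by unfold_locales (use assms in simp_all)
  have v: "0 < v" using assms(3) T_pos by auto
  have slope: "slope = \<Delta>" "icpt = \<Delta>'" using assms(6,7) by (simp_all add: slope_def icpt_def)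
  have D: "den r v = D" using assms(10) by (simp add: den_def)
  have K: "K_at r v z\<^sub>r z\<^sub>v = K" using assms(6-8) by simp
  have D_pos: "D > 0" using den_pos D by simp
  show ?thesis
  proof (intro conjI allI impI ballI D_pos; elim conjE)
    fix M :: real and A :: "real^2^2" and m :: "real^2" and Y
    assume M2: "M\<^sup>2 = K / D"
      and A: "A = (sqrt v / ((v - r) * M)) *\<^sub>R vector [vector [1, r], vector [1 / v, 1]]"
      and m: "m = (- (sqrt v / ((v - r) * M))) *\<^sub>R vector [z\<^sub>v / v, z\<^sub>r]"
      and Y: "Y = f_transform A m X"
    define c where "c = sqrt v / ((v - r) * M)"
    \<comment> \<open>Positivity of \<open>K\<close> and \<open>D\<close> excludes 0 but leaves the
      sign of \<open>M\<close> free.\<close>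
    have M: "M \<noteq> 0" using M2 D_pos assms(9) by auto
    have MD: "M\<^sup>2 * den r v = K_at r v z\<^sub>r z\<^sub>v" unfolding D K M2 using D_pos by simp
    have c: "c \<noteq> 0" using v assms(4) M by (simp add: c_def)
    have A_simps: "A$1$1 = c" "A$1$2 = c * r" "A$2$1 = c / v" "A$2$2 = c"
      unfolding A by (simp_all add: c_def)
    have m_simps: "m$1 = - c * (z\<^sub>v / v)" "m$2 = - c * z\<^sub>r"
      unfolding m by (simp_all add: c_def)
    have moebius: "moebius A t = time_change r v t" for t
    proof -
      have "moebius A t = (c * (t + r)) / (c * (1 + t / v))"
        unfolding moebius_def A_simps by (simp add: algebra_simps)
      then show ?thesis using c by (simp add: time_change_def)
    qed
    have dom: "t \<in> moebius_dom A \<longleftrightarrow> v + t \<noteq> 0" for t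
    proof -
      have "A$2$1 * t + A$2$2 = c * (v + t) / v"
        unfolding A_simps using v by (simp add: field_simps)
      then show ?thesis unfolding moebius_dom_def using c v by simp
    qed
    show "f_transform_defined A {r<..<v}"
      unfolding f_transform_defined_def
    proof (intro conjI subsetI)
      have "det A = c * c * (v - r) / v"
        unfolding det_2 A_simps using v by (simp add: field_simps)
      then show "invertible A" using c v assms(4) by (simp add: invertible_det_nz)
      show "open_interval {r<..<v}"
        using assms(4) dense[of r v] by (auto simp: open_interval_def is_interval_1)
    next
      fix x assume "x \<in> {r<..<v}"
      then have "x \<noteq> v" by simp
      note inv = time_change_inverse[OF v assms(4) this]
      show "x \<in> moebius A ` moebius_dom A"
      proof (rule image_eqI)
        show "x = moebius A (v * (x - r) / (v - x))" using inv(2) by (simp add: moebius)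
        show "v * (x - r) / (v - x) \<in> moebius_dom A" using inv(1) by (simp add: dom)
      qed
    qed
    show "f_transform_times A {r<..<v} = {0<..}"
      unfolding f_transform_times_def moebius dom
      using time_change_in_iff[OF v assms(4)] v by fastforce
    have Y_eq: "Y t \<omega> = c * ((1 + t / v) * X (time_change r v t) \<omega> - (t * (z\<^sub>v / v) + z\<^sub>r))" for t \<omega>
      unfolding Y f_transform_def moebius A_simps m_simps by (simp add: algebra_simps)
    then show "Y t \<omega> = sqrt v / ((v - r) * M) *
        ((1 + t / v) * X ((t + r) / (1 + t / v)) \<omega> - (t * (z\<^sub>v / v) + z\<^sub>r))" for t \<omega>
      by (simp add: c_def time_change_def)
    from QH_Y[OF M MD c_def Y_eq]
    show "QH Q {0<..} (natural_filtration Q {0<..} Y)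
         ((v * \<eta> - \<theta> - 2 * \<tau> * \<Delta> + 2 * \<sigma> * v * \<Delta>' - (1 - \<gamma>) * (v * \<Delta> - \<Delta>')) / (sqrt v * M * D))
         (sqrt v * (\<theta> - r * \<eta> + 2 * \<tau> * \<Delta> - 2 * r * \<sigma> * \<Delta>' - (1 - \<gamma>) * (\<Delta>' - r * \<Delta>)) / (M * D))
         ((\<sigma> * v\<^sup>2 + (1 - \<gamma>) * v + \<tau>) / (v * D))
         (v * ((\<sigma> * r\<^sup>2 + (1 - \<gamma>) * r + \<tau>) / D))
         ((v * \<gamma> - r * (v * \<sigma> + 1) - \<tau>) / D)
         Y"
      unfolding slope D .
  qed
qed

end
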